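(* If $\perp$ is a canonical independence relation, then $\perp=\perp^{\text{þ}}$, i.e. $\perp$ is thorn-forking independence.
   Context: $T$ is a complete consistent first-order theory (possibly many-sorted, e.g. of the form $T^{\mathrm{eq}}$); we work in a big saturated model of $T$. All sets are small subsets of the big model; $BC$ means $B\cup C$; $\operatorname{acl}$ is algebraic closure. $A\equiv_BA'$ means that some automorphism fixing $B$ pointwise maps the set $A$ onto $A'$; $(A,B,C)\equiv(A',B',C')$ means that some automorphism maps $A,B,C$ onto $A',B',C'$ respectively. An independence relation is a ternary relation $\perp$ between small sets satisfying: - (invariance) If $A\perp_CB$ and $(A',B',C')\equiv(A,B,C)$, then $A'\perp_{C'}B'$. - (monotonicity) If $A\perp_CB$, $A'\subseteq A$, $B'\subseteq B$, then $A'\perp_CB'$. - (base monotonicity) If $D\subseteq C\subseteq B$ and $A\perp_DB$, then $A\perp_CB$. - (transitivity) If $D\subseteq C\subseteq B$, $B\perp_CA$ and $C\perp_DA$, then $B\perp_DA$. - (normality) $A\perp_CB$ implies $AC\perp_CB$. - (extension) If $A\perp_CB$ and $\hat B\supseteq B$, then there is $A'\equiv_{BC}A$ with $A'\perp_C\hat B$. - (finite character) If $A_0\perp_CB$ for all finite $A_0\subseteq A$, then $A\perp_CB$. - (local character) For every $A$ there is a cardinal $\kappa(A)$ such that for any $B$ there is $C\subseteq B$ with $|C|<\kappa(A)$ and $A\perp_CB$. It is strict if moreover (anti-reflexivity) $a\perp_Ba$ implies $a\in\operatorname{acl}B$. It is canonical if it is strict and has the intersection property: whenever $C_1\subseteq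 B$ and $C_2\subseteq B$ are such that $A\perp_{C_1}B$ and $A\perp_{C_2}B$, then $A\perp_{\operatorname{acl}C_1\cap\operatorname{acl}C_2}B$. M-dividing independence: $A\perp^M_CB$ iff $\operatorname{acl}(AC')\cap\operatorname{acl}(BC')=\operatorname{acl}C'$ for every $C'$ with $C\subseteq C'\subseteq\operatorname{acl}(BC)$. Thorn-forking independence: $A\perp^{\text{þ}}_CB$ iff for all $\hat B\supseteq B$ there is $A'\equiv_{BC}A$ such that $A'\perp^M_C\hat B$. *)

theory Defs
  imports Main
begin

unbundle cardinal_syntax

section \<open>Many-sorted first-order logic\<close>

text \<open>The set of sorts is the whole type \<open>'s\<close>; one-sorted logic is the case of a one-element
  type.  The symbols form sets, so that a language may have no function or no relation symbols.
  A variable is a pair of its sort and an index.\<close>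

record ('s, 'f, 'r) lang =
  funs :: "'f set"
  fun_dom :: "'f \<Rightarrow> 's list"
  fun_cod :: "'f \<Rightarrow> 's"
  rels :: "'r set"
  rel_dom :: "'r \<Rightarrow> 's list"

datatype ('s, 'f) tm = Var "'s \<times> nat" | Fn 'f "('s, 'f) tm list"

datatype ('s, 'f, 'r) fm =
    Eq "('s, 'f) tm" "('s, 'f) tm"
  | Rel 'r "('s, 'f) tm list"
  | Neg "('s, 'f, 'r) fm"
  | Conj "('s, 'f, 'r) fm" "('s, 'f, 'r) fm"
  | Ex "'s \<times> nat" "('s, 'f, 'r) fm"

fun sort_tm :: "('s, 'f, 'r) lang \<Rightarrow> ('s, 'f) tm \<Rightarrow> 's" where
  "sort_tm L (Var x) = fst x"
| "sort_tm L (Fn f ts) = fun_cod L f"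

fun wf_tm :: "('s, 'f, 'r) lang \<Rightarrow> ('s, 'f) tm \<Rightarrow> bool" where
  "wf_tm L (Var x) \<longleftrightarrow> True"
| "wf_tm L (Fn f ts) \<longleftrightarrow>
     f \<in> funs L \<and> map (sort_tm L) ts = fun_dom L f \<and> (\<forall>t\<in>set ts. wf_tm L t)"

fun wf_fm :: "('s, 'f, 'r) lang \<Rightarrow> ('s, 'f, 'r) fm \<Rightarrow> bool" where
  "wf_fm L (Eq t u) \<longleftrightarrow> wf_tm L t \<and> wf_tm L u \<and> sort_tm L t = sort_tm L u"
| "wf_fm L (Rel r ts) \<longleftrightarrow>
     r \<in> rels L \<and> map (sort_tm L) ts = rel_dom L r \<and> (\<forall>t\<in>set ts. wf_tm L t)"
| "wf_fm L (Neg p) \<longleftrightarrow> wf_fm L p"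
| "wf_fm L (Conj p q) \<longleftrightarrow> wf_fm L p \<and> wf_fm L q"
| "wf_fm L (Ex x p) \<longleftrightarrow> wf_fm L p"

fun fv_tm :: "('s, 'f) tm \<Rightarrow> ('s \<times> nat) set" where
  "fv_tm (Var x) = {x}"
| "fv_tm (Fn f ts) = (\<Union>t\<in>set ts. fv_tm t)"

fun fv :: "('s, 'f, 'r) fm \<Rightarrow> ('s \<times> nat) set" where
  "fv (Eq t u) = fv_tm t \<union> fv_tm u"
| "fv (Rel r ts) = (\<Union>t\<in>set ts. fv_tm t)"
| "fv (Neg p) = fv p"
| "fv (Conj p q) = fv p \<union> fv q"
| "fv (Ex x p) = fv p - {x}"

definition sentences :: "('s, 'f, 'r) lang \<Rightarrow> ('s, 'f, 'r) fm set" where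
  "sentences L = {p. wf_fm L p \<and> fv p = {}}"

text \<open>The disjoint union of the universes of all sorts is the whole type \<open>'m\<close>, and \<open>el_sort\<close>
  gives the sort of an element.  The values of \<open>fun_int\<close> and \<open>rel_int\<close> on ill-sorted argument
  lists are irrelevant.\<close>

record ('s, 'f, 'r, 'm) struct =
  el_sort :: "'m \<Rightarrow> 's"
  fun_int :: "'f \<Rightarrow> 'm list \<Rightarrow> 'm"
  rel_int :: "'r \<Rightarrow> 'm list \<Rightarrow> bool"

definition is_struct :: "('s, 'f, 'r) lang \<Rightarrow> ('s, 'f, 'r, 'm) struct \<Rightarrow> bool" where
  "is_struct L M \<longleftrightarrow> surj (el_sort M) \<and>
     (\<forall>f\<in>funs L. \<forall>as. map (el_sort M) as = fun_dom L f \<longrightarrow>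
        el_sort M (fun_int M f as) = fun_cod L f)"

definition assignment :: "('s, 'f, 'r, 'm) struct \<Rightarrow> ('s \<times> nat \<Rightarrow> 'm) \<Rightarrow> bool" where
  "assignment M v \<longleftrightarrow> (\<forall>x. el_sort M (v x) = fst x)"

fun eval :: "('s, 'f, 'r, 'm) struct \<Rightarrow> ('s \<times> nat \<Rightarrow> 'm) \<Rightarrow> ('s, 'f) tm \<Rightarrow> 'm" where
  "eval M v (Var x) = v x"
| "eval M v (Fn f ts) = fun_int M f (map (eval M v) ts)"

fun sat :: "('s, 'f, 'r, 'm) struct \<Rightarrow> ('s \<times> nat \<Rightarrow> 'm) \<Rightarrow> ('s, 'f, 'r) fm \<Rightarrow> bool" where
  "sat M v (Eq t u) \<longleftrightarrow> eval M v t = eval M v u"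
| "sat M v (Rel r ts) \<longleftrightarrow> rel_int M r (map (eval M v) ts)"
| "sat M v (Neg p) \<longleftrightarrow> \<not> sat M v p"
| "sat M v (Conj p q) \<longleftrightarrow> sat M v p \<and> sat M v q"
| "sat M v (Ex x p) \<longleftrightarrow> (\<exists>a. el_sort M a = fst x \<and> sat M (v(x := a)) p)"

definition models ::
  "('s, 'f, 'r) lang \<Rightarrow> ('s, 'f, 'r, 'm) struct \<Rightarrow> ('s, 'f, 'r) fm set \<Rightarrow> bool" where
  "models L M T \<longleftrightarrow> is_struct L M \<and> (\<forall>p\<in>T. \<forall>v. assignment M v \<longrightarrow> sat M v p)"

text \<open>Theories are understood to be deductively closed, so a complete theory contains each
  sentence or its negation.  Consistency is the existence of a model; below, the big model
  of \<open>T\<close> is one.\<close>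

definition complete_theory :: "('s, 'f, 'r) lang \<Rightarrow> ('s, 'f, 'r) fm set \<Rightarrow> bool" where
  "complete_theory L T \<longleftrightarrow> T \<subseteq> sentences L \<and> (\<forall>p\<in>sentences L. p \<in> T \<or> Neg p \<in> T)"

definition automorphisms ::
  "('s, 'f, 'r) lang \<Rightarrow> ('s, 'f, 'r, 'm) struct \<Rightarrow> ('m \<Rightarrow> 'm) set" where
  "automorphisms L M = {g. bij g \<and> (\<forall>a. el_sort M (g a) = el_sort M a) \<and>
     (\<forall>f\<in>funs L. \<forall>as. map (el_sort M) as = fun_dom L f \<longrightarrow>
        g (fun_int M f as) = fun_int M f (map g as)) \<and>
     (\<forall>r\<in>rels L. \<forall>as. map (el_sort M) as = rel_dom L r \<longrightarrow>
        rel_int M r (map g as) = rel_int M r as)}"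

text \<open>A formula in the single variable \<open>x\<close> with parameters from \<open>B\<close> is represented by a pair
  \<open>(p, v)\<close>: the assignment \<open>v\<close> supplies the parameters for the free variables of \<open>p\<close> other
  than \<open>x\<close>.\<close>

definition param_fms :: "('s, 'f, 'r) lang \<Rightarrow> ('s, 'f, 'r, 'm) struct \<Rightarrow> 'm set \<Rightarrow> 's \<times> nat \<Rightarrow>
    (('s, 'f, 'r) fm \<times> ('s \<times> nat \<Rightarrow> 'm)) set" where
  "param_fms L M B x = {(p, v). wf_fm L p \<and> assignment M v \<and> (\<forall>y\<in>fv p - {x}. v y \<in> B)}"

definition solutions :: "('s, 'f, 'r, 'm) struct \<Rightarrow> 's \<times> nat \<Rightarrow>
    ('s, 'f, 'r) fm \<times> ('s \<times> nat \<Rightarrow> 'm) \<Rightarrow> 'm set" where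
  "solutions M x = (\<lambda>(p, v). {a. el_sort M a = fst x \<and> sat M (v(x := a)) p})"

definition acl :: "('s, 'f, 'r) lang \<Rightarrow> ('s, 'f, 'r, 'm) struct \<Rightarrow> 'm set \<Rightarrow> 'm set" where
  "acl L M B = {a. \<exists>x. \<exists>\<phi>\<in>param_fms L M B x.
     a \<in> solutions M x \<phi> \<and> finite (solutions M x \<phi>)}"

section \<open>Big saturated models\<close>

definition saturated ::
  "('s, 'f, 'r) lang \<Rightarrow> 'k rel \<Rightarrow> ('s, 'f, 'r, 'm) struct \<Rightarrow> bool" where
  "saturated L \<kappa> M \<longleftrightarrow>
     (\<forall>B x \<Phi>. |B| <o \<kappa> \<longrightarrow> \<Phi> \<subseteq> param_fms L M B x \<longrightarrow>
        (\<forall>\<Phi>0\<subseteq>\<Phi>. finite \<Phi>0 \<longrightarrow> (\<exists>a. el_sort M a = fst x \<and> (\<forall>\<phi>\<in>\<Phi>0. a \<in> solutions M x \<phi>))) \<longrightarrow>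
        (\<exists>a. el_sort M a = fst x \<and> (\<forall>\<phi>\<in>\<Phi>. a \<in> solutions M x \<phi>)))"

definition elementary_map ::
  "('s, 'f, 'r) lang \<Rightarrow> ('s, 'f, 'r, 'm) struct \<Rightarrow> 'm set \<Rightarrow> ('m \<Rightarrow> 'm) \<Rightarrow> bool" where
  "elementary_map L M A g \<longleftrightarrow>
     (\<forall>a\<in>A. el_sort M (g a) = el_sort M a) \<and>
     (\<forall>p v w. wf_fm L p \<longrightarrow> assignment M v \<longrightarrow> assignment M w \<longrightarrow>
        (\<forall>y\<in>fv p. v y \<in> A \<and> w y = g (v y)) \<longrightarrow> sat M v p = sat M w p)"

definition strongly_homogeneous ::
  "('s, 'f, 'r) lang \<Rightarrow> 'k rel \<Rightarrow> ('s, 'f, 'r, 'm) struct \<Rightarrow> bool" where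
  "strongly_homogeneous L \<kappa> M \<longleftrightarrow>
     (\<forall>A g. |A| <o \<kappa> \<longrightarrow> elementary_map L M A g \<longrightarrow> (\<exists>h\<in>automorphisms L M. \<forall>a\<in>A. h a = g a))"

text \<open>Small means of cardinality less than \<open>\<kappa>\<close>.  As usual \<open>\<kappa>\<close> has to be large enough for the
  standard constructions (e.g. extracting indiscernible sequences by the Erdos-Rado theorem) to
  stay among the small sets.  We require that iterating the power set along a well-order shorter
  than \<open>\<kappa>\<close> stays below \<open>\<kappa>\<close>, i.e. that \<open>\<kappa>\<close> is a fixed point of the beth function.  Every
  strongly inaccessible cardinal has this property, but ZFC already proves that there are
  arbitrarily large such \<open>\<kappa>\<close>.\<close>

definition big_cardinal :: "'k rel \<Rightarrow> bool" where
  "big_cardinal \<kappa> \<longleftrightarrow> Card_order \<kappa> \<and> natLeq <o \<kappa> \<and>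
     (\<forall>r :: 'k rel. Well_order r \<and> r <o \<kappa> \<longrightarrow>
        (\<exists>X :: 'k \<Rightarrow> 'k set. |\<Union>i\<in>Field r. X i| <o \<kappa> \<and>
           (\<forall>(i, j)\<in>r. i \<noteq> j \<longrightarrow> |Pow (X i)| \<le>o |X j| )))"

text \<open>A saturated model of cardinality \<open>\<kappa>\<close> is \<open>\<kappa>\<close>-saturated and strongly \<open>\<kappa>\<close>-homogeneous;
  only these two properties are required, so that the existence of such a model does not
  depend on set-theoretic hypotheses.  The cardinality of the language is the number
  of its formulas.\<close>

definition big_saturated_model ::
  "('s, 'f, 'r) lang \<Rightarrow> ('s, 'f, 'r) fm set \<Rightarrow> 'k rel \<Rightarrow> ('s, 'f, 'r, 'm) struct \<Rightarrow> bool" where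
  "big_saturated_model L T \<kappa> M \<longleftrightarrow>
     models L M T \<and> big_cardinal \<kappa> \<and> |{p. wf_fm L p}| <o \<kappa> \<and>
     saturated L \<kappa> M \<and> strongly_homogeneous L \<kappa> M"

abbreviation small :: "'k rel \<Rightarrow> 'm set \<Rightarrow> bool" where
  "small \<kappa> A \<equiv> |A| <o \<kappa>"

definition equiv_over :: "('s, 'f, 'r) lang \<Rightarrow> ('s, 'f, 'r, 'm) struct \<Rightarrow>
    'm set \<Rightarrow> 'm set \<Rightarrow> 'm set \<Rightarrow> bool" where
  "equiv_over L M B A A' \<longleftrightarrow> (\<exists>g\<in>automorphisms L M. (\<forall>b\<in>B. g b = b) \<and> g ` A = A')"

section \<open>Independence relations\<close>

text \<open>A ternary relation \<open>ind\<close> takes the base as its second argument: \<open>ind A C B\<close> says that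
  \<open>A\<close> is independent from \<open>B\<close> over \<open>C\<close>.  Only its values on small sets matter.  In local
  character the cardinal \<open>\<mu>\<close>, i.e. \<open>\<kappa>(A)\<close>, is itself small; up to order isomorphism, every
  cardinal below \<open>\<kappa>\<close> occurs as a relation on \<open>'k\<close>.\<close>

type_synonym 'm ternary = "'m set \<Rightarrow> 'm set \<Rightarrow> 'm set \<Rightarrow> bool"

locale independence_relation =
  fixes L :: "('s, 'f, 'r) lang" and \<kappa> :: "'k rel"
    and M :: "('s, 'f, 'r, 'm) struct" and ind :: "'m ternary"
  assumes invariance:
      "\<lbrakk>small \<kappa> A; small \<kappa> B; small \<kappa> C; g \<in> automorphisms L M; ind A C B\<rbrakk>
       \<Longrightarrow> ind (g ` A) (g ` C) (g ` B)"
    and monotonicity: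
      "\<lbrakk>small \<kappa> A; small \<kappa> B; small \<kappa> C; ind A C B; A' \<subseteq> A; B' \<subseteq> B\<rbrakk> \<Longrightarrow> ind A' C B'"
    and base_monotonicity:
      "\<lbrakk>small \<kappa> A; small \<kappa> B; D \<subseteq> C; C \<subseteq> B; ind A D B\<rbrakk> \<Longrightarrow> ind A C B"
    and transitivity:
      "\<lbrakk>small \<kappa> A; small \<kappa> B; D \<subseteq> C; C \<subseteq> B; ind B C A; ind C D A\<rbrakk> \<Longrightarrow> ind B D A"
    and normality:
      "\<lbrakk>small \<kappa> A; small \<kappa> B; small \<kappa> C; ind A C B\<rbrakk> \<Longrightarrow> ind (A \<union> C) C B"
    and extension:
      "\<lbrakk>small \<kappa> A; small \<kappa> B'; small \<kappa> C; ind A C B; B \<subseteq> B'\<rbrakk>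
       \<Longrightarrow> \<exists>A'. equiv_over L M (B \<union> C) A A' \<and> ind A' C B'"
    and finite_character:
      "\<lbrakk>small \<kappa> A; small \<kappa> B; small \<kappa> C; \<And>A0. A0 \<subseteq> A \<Longrightarrow> finite A0 \<Longrightarrow> ind A0 C B\<rbrakk>
       \<Longrightarrow> ind A C B"
    and local_character:
      "small \<kappa> A \<Longrightarrow> \<exists>\<mu> :: 'k rel. Card_order \<mu> \<and> \<mu> <o \<kappa> \<and>
         (\<forall>B. small \<kappa> B \<longrightarrow> (\<exists>C\<subseteq>B. |C| <o \<mu> \<and> ind A C B))"

locale strict_independence_relation = independence_relation +
  assumes anti_reflexivity: "\<lbrakk>small \<kappa> B; ind {a} B {a}\<rbrakk> \<Longrightarrow> a \<in> acl L M B"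

locale canonical_independence_relation = strict_independence_relation +
  assumes intersection_property:
    "\<lbrakk>small \<kappa> A; small \<kappa> B; C1 \<subseteq> B; C2 \<subseteq> B; ind A C1 B; ind A C2 B\<rbrakk>
     \<Longrightarrow> ind A (acl L M C1 \<inter> acl L M C2) B"

definition M_independent ::
  "('s, 'f, 'r) lang \<Rightarrow> ('s, 'f, 'r, 'm) struct \<Rightarrow> 'm ternary" where
  "M_independent L M A C B \<longleftrightarrow>
     (\<forall>C'. C \<subseteq> C' \<longrightarrow> C' \<subseteq> acl L M (B \<union> C) \<longrightarrow>
        acl L M (A \<union> C') \<inter> acl L M (B \<union> C') = acl L M C')"

definition thorn_independent ::
  "('s, 'f, 'r) lang \<Rightarrow> 'k rel \<Rightarrow> ('s, 'f, 'r, 'm) struct \<Rightarrow> 'm ternary" where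
  "thorn_independent L \<kappa> M A C B \<longleftrightarrow>
     (\<forall>B'. small \<kappa> B' \<longrightarrow> B \<subseteq> B' \<longrightarrow>
        (\<exists>A'. equiv_over L M (B \<union> C) A A' \<and> M_independent L M A' C B'))"

end

theory Submission
  imports Defs
begin

text \<open>
  Symmetry and anti-reflexivity show that independence implies M-independence, and extension
  turns this into thorn-independence.

  Conversely, let \<open>A\<close> be thorn-independent from \<open>B\<close> over \<open>C\<close>, and write \<open>BC\<close> for \<open>B \<union> C\<close>.  There
  is a long sequence of conjugates \<open>A\<^sub>i\<close> of \<open>A\<close> over \<open>BC\<close> such that, \<open>X\<^sub>i\<close> being the union of the
  earlier terms, \<open>A\<^sub>i\<close> is M-independent from \<open>B X\<^sub>i\<close> over \<open>C\<close> and independent from \<open>X\<^sub>i\<close> over \<open>BC\<close>.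
  Transitivity makes \<open>X\<^sub>i\<close> M-independent from \<open>B\<close> over \<open>C\<close>, so \<open>acl (BC) \<inter> acl (C X\<^sub>i) = acl C\<close>.
  By local character and symmetry, some \<open>A\<^sub>i\<close> is independent from \<open>B\<close> over \<open>C X\<^sub>i\<close>.  This \<open>A\<^sub>i\<close> is
  independent from \<open>B C X\<^sub>i\<close> over both \<open>BC\<close> and \<open>C X\<^sub>i\<close>, hence over \<open>acl C\<close> by the intersection
  property.  Therefore \<open>A\<^sub>i\<close>, and with it \<open>A\<close>, is independent from \<open>B\<close> over \<open>C\<close>.

  No indiscernible sequences are needed, not even for symmetry: moving the new term instead of
  the old ones, extension directly builds a sequence whose initial segments are independent
  from the next term.
\<close>

section \<open>Cardinals\<close>

lemma infinite_Field:
  assumes "Card_order \<kappa>" "natLeq <o \<kappa>"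
  shows "\<not> finite (Field \<kappa>)"
  using assms card_of_Field_ordIso finite_iff_ordLess_natLeq not_ordLess_ordLeq
    ordIso_ordLess_trans ordIso_symmetric ordLess_imp_ordLeq by metis

lemma card_of_finite_ordLeq_infinite: "finite X \<Longrightarrow> \<not> finite B \<Longrightarrow> |X| \<le>o |B|"
  using card_of_Well_order ordLeq_total card_of_ordLeq_finite by metis

lemma card_of_UNION_finite_ordLess:
  fixes \<kappa> :: "'k rel" and S :: "'i \<Rightarrow> 'a set"
  assumes "Card_order \<kappa>" "natLeq <o \<kappa>" "|I| <o \<kappa>" "\<And>i. i \<in> I \<Longrightarrow> finite (S i)"
  shows "|\<Union>i\<in>I. S i| <o \<kappa>"
proof -
  have inf: "\<not> finite (Field \<kappa>)"
    by (rule infinite_Field[OF assms(1,2)])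
  have N: "|UNIV :: nat set| <o \<kappa>"
    using assms(2) card_of_nat ordIso_ordLess_trans by blast
  \<comment> \<open>The summand \<open>nat\<close> makes the bounding set infinite even when
    \<open>I\<close> is finite.\<close>
  let ?J = "I <+> (UNIV :: nat set)"
  have "|?J| <o \<kappa>"
    by (rule card_of_Plus_ordLess_infinite_Field[OF inf assms(1,3) N])
  moreover have "|\<Union>i\<in>I. S i| \<le>o |?J|"
  proof (rule card_of_UNION_ordLeq_infinite)
    show "\<not> finite ?J" by simp
    show "|I| \<le>o |?J|" by (rule card_of_Plus1)
    show "\<forall>i\<in>I. |S i| \<le>o |?J|"
      using assms(4) by (auto intro!: card_of_finite_ordLeq_infinite)
  qed
  ultimately show ?thesis by (rule ordLeq_ordLess_trans[rotated])
qed

text \<open>Serves to count parameter tuples of formulas. By induction there are at most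
  \<open>|?B|\<close> lists of each fixed length, because \<open>?B\<close> is infinite and so
  absorbs \<open>?B \<times> ?B\<close>; there are only countably many lengths.\<close>

lemma card_of_lists_ordLess:
  fixes \<kappa> :: "'k rel"
  assumes "Card_order \<kappa>" "natLeq <o \<kappa>" "|A| <o \<kappa>"
  shows "|lists A| <o \<kappa>"
proof -
  have inf: "\<not> finite (Field \<kappa>)"
    by (rule infinite_Field[OF assms(1,2)])
  have N: "|UNIV :: nat set| <o \<kappa>"
    using assms(2) card_of_nat ordIso_ordLess_trans by blast
  let ?B = "A <+> (UNIV :: nat set)"
  have infB: "\<not> finite ?B" by simp
  have B: "|?B| <o \<kappa>"
    by (rule card_of_Plus_ordLess_infinite_Field[OF inf assms(1,3) N])
  have len: "|{xs \<in> lists A. length xs = n}| \<le>o |?B|" for n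
  proof (induction n)
    case 0
    have "{xs \<in> lists A. length xs = 0} = {[]}" by auto
    then show ?case
      using card_of_finite_ordLeq_infinite[OF _ infB, of "{[]}"] by simp
  next
    case (Suc n)
    have "{xs \<in> lists A. length xs = Suc n} \<subseteq> (\<lambda>(x, xs). x # xs) ` (A \<times> {xs \<in> lists A. length xs = n})"
      (is "?L \<subseteq> _ ` ?R")
    proof
      fix ys assume "ys \<in> ?L"
      then obtain x xs where "ys = x # xs" "(x, xs) \<in> ?R" by (cases ys) auto
      then show "ys \<in> (\<lambda>(x, xs). x # xs) ` ?R"
        using image_eqI[of ys "\<lambda>(x, xs). x # xs" "(x, xs)" ?R] by simp
    qed
    then have "|?L| \<le>o |?R|" by (rule ordLeq_transitive[OF card_of_mono1 card_of_image])
    also have "|?R| \<le>o |?B \<times> ?B|"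
      using card_of_Times_mono1[OF card_of_Plus1, of A "{xs \<in> lists A. length xs = n}"]
        card_of_Times_mono2[OF Suc, of ?B] ordLeq_transitive by blast
    also have "|?B \<times> ?B| =o |?B|"
      using infB by (rule card_of_Times_same_infinite)
    finally show ?case .
  qed
  have "|lists A| \<le>o |\<Union>n. {xs \<in> lists A. length xs = n}|"
    by (intro card_of_mono1) auto
  also have "|\<Union>n. {xs \<in> lists A. length xs = n}| \<le>o |?B|"
    using infB len by (intro card_of_UNION_ordLeq_infinite) (auto intro: card_of_Plus2)
  also note B
  finally show ?thesis .
qed

lemma card_of_Times_ordLess:
  fixes \<kappa> :: "'k rel"
  assumes "Card_order \<kappa>" "natLeq <o \<kappa>" "|A| <o \<kappa>" "|B| <o \<kappa>"
  shows "|A \<times> B| <o \<kappa>"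
proof -
  note inf = infinite_Field[OF assms(1,2)]
  have N: "|UNIV :: nat set| <o \<kappa>"
    using assms(2) card_of_nat ordIso_ordLess_trans by blast
  let ?C = "(A <+> B) <+> (UNIV :: nat set)"
  have "|A| \<le>o |?C|" "|B| \<le>o |?C|"
    by (rule ordLeq_transitive[OF card_of_Plus1 card_of_Plus1],
        rule ordLeq_transitive[OF card_of_Plus2 card_of_Plus1])
  then have "|A \<times> B| \<le>o |?C|"
    by (intro card_of_Sigma_ordLeq_infinite) auto
  also have "|?C| <o \<kappa>"
    by (intro card_of_Plus_ordLess_infinite_Field inf assms N)
  finally show ?thesis .
qed

text \<open>The sets \<open>X i\<close> of a beth sequence have at least as many elements as \<open>i\<close> has predecessors,
  so a sequence of length beyond \<open>\<mu> + 1\<close> exhibits a power set between \<open>\<mu>\<close> and \<open>\<kappa>\<close>.\<close>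

lemma big_cardinal_cardSuc:
  fixes \<kappa> :: "'k rel" and \<mu> :: "'i rel"
  assumes big: "big_cardinal \<kappa>" and \<mu>: "Card_order \<mu>" "\<mu> <o \<kappa>"
  shows "cardSuc \<mu> <o \<kappa>"
proof -
  have C: "Card_order \<kappa>" and W: "Well_order \<kappa>"
    using big unfolding big_cardinal_def card_order_on_def by auto
  then interpret wo: wo_rel \<kappa> by (simp add: wo_rel_def)
  have tr: "(x, z) \<in> \<kappa>" if "(x, y) \<in> \<kappa>" "(y, z) \<in> \<kappa>" for x y z
    using wo.TRANS that by (meson transD)
  have an: "x = y" if "(x, y) \<in> \<kappa>" "(y, x) \<in> \<kappa>" for x y
    using wo.ANTISYM that by (meson antisymD)
  have lim: "\<exists>b\<in>Field \<kappa>. a \<noteq> b \<and> (a, b) \<in> \<kappa>" if "a \<in> Field \<kappa>" for a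
    using infinite_Card_order_limit[OF C infinite_Field[OF C] that] big unfolding big_cardinal_def by blast
  have W\<mu>: "Well_order \<mu>" using \<mu>(1) unfolding card_order_on_def by auto
  \<comment> \<open>The segment below \<open>a\<close> has the order type of \<open>\<mu>\<close>.
    Two further indices are needed: \<open>b\<close>, whose set \<open>X b\<close> is at least as
    large as \<open>Pow (X a)\<close>, and \<open>c\<close>, which cuts off a segment
    \<open>r\<close> containing both \<open>a\<close> and \<open>b\<close>.\<close>
  obtain a where a: "a \<in> Field \<kappa>" "\<mu> =o Restr \<kappa> (underS \<kappa> a)"
    using ordLess_iff_ordIso_Restr[OF W W\<mu>] \<mu>(2) by blast
  obtain b where b: "b \<in> Field \<kappa>" "a \<noteq> b" "(a, b) \<in> \<kappa>" using lim[OF a(1)] by blast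
  obtain c where c: "c \<in> Field \<kappa>" "b \<noteq> c" "(b, c) \<in> \<kappa>" using lim[OF b(1)] by blast
  define r where "r = Restr \<kappa> (underS \<kappa> c)"
  have Wr: "Well_order r" unfolding r_def by (rule Well_order_Restr[OF W])
  have rk: "r <o \<kappa>" unfolding r_def by (rule underS_Restr_ordLess[OF W]) (use c in blast)
  have ac: "(a, c) \<in> \<kappa>" "a \<noteq> c"
    using b c tr an by blast+
  have rin: "(x, y) \<in> r \<longleftrightarrow> (x, y) \<in> \<kappa> \<and> (y, c) \<in> \<kappa> \<and> y \<noteq> c" for x y
  proof -
    have "(x, c) \<in> \<kappa> \<and> x \<noteq> c" if "(x, y) \<in> \<kappa>" "(y, c) \<in> \<kappa>" "y \<noteq> c"
      using tr[OF that(1,2)] an that by metis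
    then show ?thesis by (auto simp: r_def underS_def)
  qed
  have "\<forall>s :: 'k rel. Well_order s \<and> s <o \<kappa> \<longrightarrow> (\<exists>X :: 'k \<Rightarrow> 'k set.
      |\<Union>i\<in>Field s. X i| <o \<kappa> \<and> (\<forall>(i, j)\<in>s. i \<noteq> j \<longrightarrow> |Pow (X i)| \<le>o |X j| ))"
    using big unfolding big_cardinal_def by (elim conjE)
  from this[rule_format, OF conjI[OF Wr rk]] obtain X :: "'k \<Rightarrow> 'k set"
    where X1: "|\<Union>i\<in>Field r. X i| <o \<kappa>"
      and X2: "\<forall>(i, j)\<in>r. i \<noteq> j \<longrightarrow> |Pow (X i)| \<le>o |X j|"
    by (elim exE conjE)
  have X2: "|Pow (X i)| \<le>o |X j|" if "(i, j) \<in> r" "i \<noteq> j" for i j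
    using bspec[OF X2 that(1)] that(2) by simp
  \<comment> \<open>For \<open>j\<close> before \<open>i\<close>, the segment below \<open>j\<close>
    is at most \<open>|X j|\<close>, hence strictly below \<open>|Pow (X j)|\<close> and so below
    \<open>|X i|\<close>. A well-order all of whose proper initial segments are strictly below
    \<open>|X i|\<close> is itself at most \<open>|X i|\<close>.\<close>
  have low: "i \<in> Field r \<Longrightarrow> Restr r (underS r i) \<le>o |X i|" for i
  proof (induction i rule: wo_rel.well_order_induct[of r])
    show "wo_rel r" using Wr by (simp add: wo_rel_def)
    fix i assume IH: "\<forall>j. j \<noteq> i \<and> (j, i) \<in> r \<longrightarrow> j \<in> Field r \<longrightarrow> Restr r (underS r j) \<le>o |X j|"
      and i: "i \<in> Field r"
    let ?R = "Restr r (underS r i)"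
    interpret r: wo_rel r using Wr by (simp add: wo_rel_def)
    have tr: "(x, z) \<in> r" if "(x, y) \<in> r" "(y, z) \<in> r" for x y z
      using r.TRANS that by (meson transD)
    have an: "x = y" if "(x, y) \<in> r" "(y, x) \<in> r" for x y
      using r.ANTISYM that by (meson antisymD)
    show "?R \<le>o |X i|"
    proof (subst ordLeq_iff_ordLess_Restr[OF Well_order_Restr[OF Wr] card_of_Well_order], rule ballI)
      fix j assume "j \<in> Field ?R"
      then have j: "j \<noteq> i" "(j, i) \<in> r" "j \<in> Field r"
        by (auto simp: Field_def underS_def)
      have "underS ?R j = underS r j"
        using j tr an unfolding underS_def by blast
      moreover have "Restr ?R (underS r j) = Restr r (underS r j)"
        using j tr an unfolding underS_def by blast
      ultimately have "Restr ?R (underS ?R j) \<le>o |X j|" using IH j by simp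
      also have "|X j| <o |Pow (X j)|" by (rule card_of_Pow)
      also have "|Pow (X j)| \<le>o |X i|" using X2[OF j(2,1)] .
      finally show "Restr ?R (underS ?R j) <o |X i|" .
    qed
  qed
  have ab: "(a, b) \<in> r" using b c rin by blast
  then have aF: "a \<in> Field r" "b \<in> Field r" by (auto simp: Field_def)
  have "underS r a = underS \<kappa> a"
    unfolding underS_def using rin ac by blast
  moreover have "Restr r (underS \<kappa> a) = Restr \<kappa> (underS \<kappa> a)"
    using rin ac tr an unfolding underS_def by blast
  ultimately have "\<mu> \<le>o |X a|" using low[OF aF(1)] a(2) ordIso_ordLeq_trans by metis
  then have "\<mu> <o |Pow (X a)|" using card_of_Pow ordLeq_ordLess_trans by blast
  then have "cardSuc \<mu> \<le>o |Pow (X a)|" using cardSuc_least[OF \<mu>(1) card_of_Card_order] by blast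
  also have "|Pow (X a)| \<le>o |X b|" using X2[OF ab b(2)] .
  also have "|X b| \<le>o |\<Union>i\<in>Field r. X i|" using aF(2) by (intro card_of_mono1) blast
  also note X1
  finally show ?thesis .
qed

section \<open>Automorphisms and algebraic closure\<close>

lemma finite_fv_tm: "finite (fv_tm t)"
  by (induction t) auto

lemma finite_fv: "finite (fv p)"
  by (induction p) (auto simp: finite_fv_tm)

lemma eval_cong: "(\<And>y. y \<in> fv_tm t \<Longrightarrow> v y = w y) \<Longrightarrow> eval M v t = eval M w t"
proof (induction t)
  case (Fn f ts)
  then have "map (eval M v) ts = map (eval M w) ts" by auto
  then show ?case by (simp only: eval.simps)
qed auto

lemma sat_cong: "(\<And>y. y \<in> fv p \<Longrightarrow> v y = w y) \<Longrightarrow> sat M v p = sat M w p"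
proof (induction p arbitrary: v w)
  case (Eq t u)
  then show ?case using eval_cong[of t v w M] eval_cong[of u v w M] by auto
next
  case (Rel r ts)
  then have "map (eval M v) ts = map (eval M w) ts" by (auto intro!: eval_cong)
  then show ?case by (simp only: sat.simps)
next
  case (Neg p)
  have "sat M v p = sat M w p" by (rule Neg.IH) (use Neg.prems in simp)
  then show ?case by simp
next
  case (Conj p q)
  have "sat M v p = sat M w p" by (rule Conj.IH) (use Conj.prems in simp)
  moreover have "sat M v q = sat M w q" by (rule Conj.IH) (use Conj.prems in simp)
  ultimately show ?case by simp
next
  case (Ex x p)
  have "sat M (v(x := a)) p = sat M (w(x := a)) p" for a
    using Ex.prems by (intro Ex.IH) auto
  then show ?case by simp
qed

lemma el_sort_eval:
  assumes "is_struct L M" "assignment M v"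
  shows "wf_tm L t \<Longrightarrow> el_sort M (eval M v t) = sort_tm L t"
proof (induction t)
  case (Fn f ts)
  have "map (el_sort M) (map (eval M v) ts) = map (sort_tm L) ts"
    unfolding map_map by (rule map_cong[OF refl]) (use Fn in simp)
  also have "map (sort_tm L) ts = fun_dom L f" using Fn.prems by simp
  finally show ?case using Fn.prems assms(1) by (simp add: is_struct_def)
qed (use assms(2) in \<open>simp add: assignment_def del: split_paired_All\<close>)

lemma automorphism_el_sort: "g \<in> automorphisms L M \<Longrightarrow> el_sort M (g a) = el_sort M a"
  by (simp add: automorphisms_def)

lemma automorphism_bij: "g \<in> automorphisms L M \<Longrightarrow> bij g"
  by (simp add: automorphisms_def)

lemma automorphism_fun_int:
  "g \<in> automorphisms L M \<Longrightarrow> f \<in> funs L \<Longrightarrow> map (el_sort M) as = fun_dom L f \<Longrightarrow>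
     g (fun_int M f as) = fun_int M f (map g as)"
  by (simp add: automorphisms_def)

lemma automorphism_rel_int:
  "g \<in> automorphisms L M \<Longrightarrow> r \<in> rels L \<Longrightarrow> map (el_sort M) as = rel_dom L r \<Longrightarrow>
     rel_int M r (map g as) = rel_int M r as"
  by (simp add: automorphisms_def)

lemma eval_automorphism:
  assumes "is_struct L M" "assignment M v" "g \<in> automorphisms L M"
  shows "wf_tm L t \<Longrightarrow> eval M (g \<circ> v) t = g (eval M v t)"
proof (induction t)
  case (Fn f ts)
  have "map (el_sort M) (map (eval M v) ts) = map (sort_tm L) ts"
    unfolding map_map by (rule map_cong[OF refl]) (use Fn.prems el_sort_eval[OF assms(1,2)] in simp)
  also have "map (sort_tm L) ts = fun_dom L f" using Fn.prems by simp
  finally have s: "map (el_sort M) (map (eval M v) ts) = fun_dom L f" .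
  have m: "map (eval M (g \<circ> v)) ts = map g (map (eval M v) ts)"
    unfolding map_map by (rule map_cong[OF refl]) (use Fn in \<open>simp del: comp_apply add: comp_apply[of g "eval M v"]\<close>)
  have "g (fun_int M f (map (eval M v) ts)) = fun_int M f (map g (map (eval M v) ts))"
    by (rule automorphism_fun_int[OF assms(3) _ s]) (use Fn.prems in simp)
  then show ?case using m by (metis eval.simps(2))
qed simp

lemma assignment_upd: "assignment M v \<Longrightarrow> el_sort M a = fst x \<Longrightarrow> assignment M (v(x := a))"
  unfolding assignment_def by (simp del: split_paired_All)

lemma sat_automorphism:
  assumes "is_struct L M" "g \<in> automorphisms L M"
  shows "wf_fm L p \<Longrightarrow> assignment M v \<Longrightarrow> sat M (g \<circ> v) p = sat M v p"
proof (induction p arbitrary: v)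
  case (Eq t u)
  then have "eval M (g \<circ> v) t = g (eval M v t)" "eval M (g \<circ> v) u = g (eval M v u)"
    using eval_automorphism[OF assms(1) _ assms(2)] by simp_all
  then show ?case
    using automorphism_bij[OF assms(2)] by (metis bij_def injD sat.simps(1))
next
  case (Rel r ts)
  have "map (el_sort M) (map (eval M v) ts) = map (sort_tm L) ts"
    unfolding map_map by (rule map_cong[OF refl]) (use Rel.prems el_sort_eval[OF assms(1)] in simp)
  also have "map (sort_tm L) ts = rel_dom L r" using Rel.prems by simp
  finally have s: "map (el_sort M) (map (eval M v) ts) = rel_dom L r" .
  have m: "map (eval M (g \<circ> v)) ts = map g (map (eval M v) ts)"
    unfolding map_map
    by (rule map_cong[OF refl])
      (use Rel eval_automorphism[OF assms(1) _ assms(2)] in \<open>simp del: comp_apply add: comp_apply[of g "eval M v"]\<close>)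
  have "rel_int M r (map g (map (eval M v) ts)) = rel_int M r (map (eval M v) ts)"
    by (rule automorphism_rel_int[OF assms(2) _ s]) (use Rel.prems in simp)
  then show ?case using m by (metis sat.simps(2))
next
  case (Ex x p)
  have eq: "sat M ((g \<circ> v)(x := g a)) p = sat M (v(x := a)) p" if "el_sort M a = fst x" for a
  proof -
    have "(g \<circ> v)(x := g a) = g \<circ> (v(x := a))" by auto
    moreover have "sat M (g \<circ> (v(x := a))) p = sat M (v(x := a)) p"
      by (rule Ex.IH[OF _ assignment_upd[OF Ex.prems(2) that]]) (use Ex.prems(1) in simp)
    ultimately show ?thesis by metis
  qed
  \<comment> \<open>Surjectivity of \<open>g\<close> lets every witness \<open>b\<close> be written
    as \<open>g a\<close>.\<close>
  have "(\<exists>b. el_sort M b = fst x \<and> sat M ((g \<circ> v)(x := b)) p) \<longleftrightarrow>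
      (\<exists>a. el_sort M (g a) = fst x \<and> sat M ((g \<circ> v)(x := g a)) p)"
    using automorphism_bij[OF assms(2)] by (metis bij_pointE)
  also have "\<dots> \<longleftrightarrow> (\<exists>a. el_sort M a = fst x \<and> sat M (v(x := a)) p)"
    using eq automorphism_el_sort[OF assms(2)] by (simp only: cong: conj_cong)
  finally show ?case unfolding sat.simps .
qed auto

section \<open>The group of automorphisms\<close>

lemma id_automorphism: "id \<in> automorphisms L M"
  by (simp add: automorphisms_def)

lemma comp_automorphism:
  assumes "g \<in> automorphisms L M" "h \<in> automorphisms L M"
  shows "g \<circ> h \<in> automorphisms L M"
proof -
  have m: "map (el_sort M) (map h as) = map (el_sort M) as" for as
    using automorphism_el_sort[OF assms(2)] by simp
  have mm: "map (g \<circ> h) as = map g (map h as)" for as by simp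
  have b: "bij (g \<circ> h)" using assms[THEN automorphism_bij] by (rule bij_comp[rotated])
  show ?thesis
    unfolding automorphisms_def
  proof (intro CollectI conjI ballI allI impI)
    fix f as assume "f \<in> funs L" "map (el_sort M) as = fun_dom L f"
    then show "(g \<circ> h) (fun_int M f as) = fun_int M f (map (g \<circ> h) as)"
      using automorphism_fun_int[OF assms(1)] automorphism_fun_int[OF assms(2)] m
      unfolding mm comp_apply by metis
  next
    fix r as assume "r \<in> rels L" "map (el_sort M) as = rel_dom L r"
    then show "rel_int M r (map (g \<circ> h) as) = rel_int M r as"
      using automorphism_rel_int[OF assms(1)] automorphism_rel_int[OF assms(2)] m
      unfolding mm by metis
  qed (use b automorphism_el_sort[OF assms(1)] automorphism_el_sort[OF assms(2)] in auto)
qed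

lemma inv_automorphism:
  assumes g: "g \<in> automorphisms L M"
  shows "inv g \<in> automorphisms L M"
proof -
  have b: "bij g" using g by (rule automorphism_bij)
  then have c: "g (inv g a) = a" "inv g (g a) = a" for a
    by (simp_all add: bij_is_surj surj_f_inv_f bij_is_inj inv_f_f)
  have s: "el_sort M (inv g a) = el_sort M a" for a
    using automorphism_el_sort[OF g] c(1) by metis
  have m: "map (el_sort M) (map (inv g) as) = map (el_sort M) as" "map g (map (inv g) as) = as" for as
    using s by (simp_all add: c comp_def)
  have "inv g (fun_int M f as) = fun_int M f (map (inv g) as)"
    if "f \<in> funs L" "map (el_sort M) as = fun_dom L f" for f as
  proof -
    have "g (fun_int M f (map (inv g) as)) = fun_int M f as"
      using g that m[of as] unfolding automorphisms_def by simp
    then show ?thesis using c(2) by metis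
  qed
  moreover have "rel_int M r (map (inv g) as) = rel_int M r as"
    if "r \<in> rels L" "map (el_sort M) as = rel_dom L r" for r as
    using automorphism_rel_int[OF g that(1), of "map (inv g) as"] that(2) m by metis
  ultimately show ?thesis
    using s bij_imp_bij_inv[OF b] by (simp add: automorphisms_def)
qed

section \<open>Basic properties of algebraic closure\<close>

lemma acl_mono: "B \<subseteq> B' \<Longrightarrow> acl L M B \<subseteq> acl L M B'"
  unfolding acl_def param_fms_def by blast

lemma subset_acl:
  assumes "is_struct L M"
  shows "B \<subseteq> acl L M B"
proof
  fix b assume b: "b \<in> B"
  let ?x = "(el_sort M b, 0 :: nat)" and ?y = "(el_sort M b, 1 :: nat)"
  \<comment> \<open>Assignments are total, so a value is needed in every sort; \<open>u\<close>
    picks one. With \<open>b\<close> stored at \<open>?y\<close>, the equation of the two variables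
    defines exactly \<open>{b}\<close>.\<close>
  obtain u where u: "\<And>s. el_sort M (u s) = s"
    using assms unfolding is_struct_def surj_def by metis
  define v where "v = (\<lambda>z. u (fst z))(?y := b)"
  have "assignment M v" using u by (simp add: assignment_def v_def)
  then have "(Eq (Var ?x) (Var ?y), v) \<in> param_fms L M B ?x"
    using b by (auto simp: param_fms_def v_def)
  moreover have "solutions M ?x (Eq (Var ?x) (Var ?y), v) = {b}"
    by (auto simp: solutions_def v_def)
  ultimately show "b \<in> acl L M B" unfolding acl_def by force
qed

text \<open>A formula has finitely many free variables and therefore mentions only finitely many
  parameters.\<close>

lemma acl_finite_character:
  assumes "a \<in> acl L M B"
  obtains B0 where "finite B0" "B0 \<subseteq> B" "a \<in> acl L M B0"
proof -
  obtain x p v where *: "(p, v) \<in> param_fms L M B x" "a \<in> solutions M x (p, v)"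
    "finite (solutions M x (p, v))"
    using assms unfolding acl_def by auto
  let ?B0 = "v ` (fv p - {x})"
  have "(p, v) \<in> param_fms L M ?B0 x" using *(1) by (auto simp: param_fms_def)
  then have "a \<in> acl L M ?B0" using * unfolding acl_def by blast
  moreover have "finite ?B0" "?B0 \<subseteq> B" using *(1) by (auto simp: finite_fv param_fms_def)
  ultimately show ?thesis using that by blast
qed

text \<open>Composing the parameter assignment with \<open>g\<close> replaces the solution set of a
  formula by its image under \<open>g\<close>, which is again finite.\<close>

lemma image_acl_subset:
  assumes "is_struct L M" and g: "g \<in> automorphisms L M"
  shows "g ` acl L M B \<subseteq> acl L M (g ` B)"
proof safe
  fix a assume "a \<in> acl L M B"
  then obtain x p v where *: "(p, v) \<in> param_fms L M B x" "a \<in> solutions M x (p, v)"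
    "finite (solutions M x (p, v))"
    unfolding acl_def by auto
  have v: "wf_fm L p" "assignment M v" using *(1) by (auto simp: param_fms_def)
  have "assignment M (g \<circ> v)"
    using v(2) automorphism_el_sort[OF g] by (simp add: assignment_def)
  then have p: "(p, g \<circ> v) \<in> param_fms L M (g ` B) x"
    using *(1) by (auto simp: param_fms_def)
  have eq: "g b \<in> solutions M x (p, g \<circ> v) \<longleftrightarrow> b \<in> solutions M x (p, v)" for b
  proof -
    have "(g \<circ> v)(x := g b) = g \<circ> (v(x := b))" by auto
    moreover have "el_sort M b = fst x \<Longrightarrow> assignment M (v(x := b))"
      using v(2) by (rule assignment_upd)
    ultimately show ?thesis
      using sat_automorphism[OF assms v(1), of "v(x := b)"] automorphism_el_sort[OF g, of b]
      by (auto simp: solutions_def)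
  qed
  then have "solutions M x (p, g \<circ> v) = g ` solutions M x (p, v)"
    using bij_is_surj[OF automorphism_bij[OF g]] by (auto simp: set_eq_iff image_iff) (metis surjD)
  then have "g a \<in> solutions M x (p, g \<circ> v)" "finite (solutions M x (p, g \<circ> v))"
    using *(2,3) by simp_all
  then show "g a \<in> acl L M (g ` B)" unfolding acl_def mem_Collect_eq using p by (intro exI bexI conjI)
qed

lemma image_acl:
  assumes "is_struct L M" and g: "g \<in> automorphisms L M"
  shows "g ` acl L M B = acl L M (g ` B)"
proof
  have i: "inv g ` g ` X = X" "g ` inv g ` X = X" for X
    using automorphism_bij[OF g] by (simp_all add: bij_is_inj bij_is_surj image_inv_f_f image_f_inv_f)
  have "inv g ` acl L M (g ` B) \<subseteq> acl L M B"
    using image_acl_subset[OF assms(1) inv_automorphism[OF g], of "g ` B"] i by simp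
  then show "acl L M (g ` B) \<subseteq> g ` acl L M B"
    using i(2) image_mono by metis
qed (rule image_acl_subset[OF assms])

text \<open>The solution set of a formula depends only on the formula, its variable and the list of
  its parameters, so there are few algebraic formulas although assignments are total.\<close>

lemma card_of_acl_ordLess:
  fixes \<kappa> :: "'k rel" and L :: "('s, 'f, 'r) lang"
  assumes "Card_order \<kappa>" "natLeq <o \<kappa>" "|{p. wf_fm L p}| <o \<kappa>" "|B| <o \<kappa>"
  shows "|acl L M B| <o \<kappa>"
proof -
  define en :: "('s \<times> nat) set \<Rightarrow> ('s \<times> nat) list" where "en S = (SOME l. set l = S)" for S
  have en: "set (en S) = S" if "finite S" for S
    unfolding en_def using finite_list[OF that] by (rule someI_ex)
  \<comment> \<open>The key \<open>Ex x p\<close> is one formula that determines both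
    \<open>x\<close> and \<open>p\<close>, so variables need no separate count. Listing its free
    variables by \<open>en\<close> turns the relevant part of an assignment into a list over
    \<open>B\<close>.\<close>
  define S where "S = (\<lambda>(q, l). {a. \<exists>x p v. (p, v) \<in> param_fms L M B x \<and>
    finite (solutions M x (p, v)) \<and> q = Ex x p \<and> l = map v (en (fv q)) \<and> a \<in> solutions M x (p, v)})"
  let ?I = "{p. wf_fm L p} \<times> lists B"
  have "|?I| <o \<kappa>"
    by (rule card_of_Times_ordLess[OF assms(1,2,3) card_of_lists_ordLess[OF assms(1,2,4)]])
  moreover have "finite (S k)" for k
  proof (cases "S k = {}")
    case False
    then obtain x p v where *: "finite (solutions M x (p, v))" "k = (Ex x p, map v (en (fv (Ex x p))))"
      unfolding S_def by (auto split: prod.splits)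
    have "S k \<subseteq> solutions M x (p, v)"
    proof
      fix a assume "a \<in> S k"
      then obtain w where w: "a \<in> solutions M x (p, w)"
        "map w (en (fv (Ex x p))) = map v (en (fv (Ex x p)))"
        unfolding S_def using *(2) by auto
      have "\<forall>y\<in>fv p - {x}. w y = v y"
        using w(2) en[of "fv p - {x}"] by (auto simp: finite_fv)
      then have "sat M (w(x := a)) p = sat M (v(x := a)) p"
        by (intro sat_cong) auto
      then show "a \<in> solutions M x (p, v)" using w(1) by (simp add: solutions_def)
    qed
    then show ?thesis using *(1) finite_subset by blast
  qed simp
  moreover have "acl L M B \<subseteq> (\<Union>k\<in>?I. S k)"
  proof
    fix a assume "a \<in> acl L M B"
    then obtain x p v where *: "(p, v) \<in> param_fms L M B x" "a \<in> solutions M x (p, v)"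
      "finite (solutions M x (p, v))"
      unfolding acl_def by auto
    let ?k = "(Ex x p, map v (en (fv (Ex x p))))"
    have "?k \<in> ?I"
      using *(1) en[of "fv p - {x}"] by (auto simp: param_fms_def finite_fv)
    moreover have "a \<in> S ?k" unfolding S_def using * by blast
    ultimately show "a \<in> (\<Union>k\<in>?I. S k)" by blast
  qed
  ultimately show ?thesis
    using card_of_UNION_finite_ordLess[OF assms(1,2), of ?I S] card_of_mono1 ordLeq_ordLess_trans by blast
qed

section \<open>M-independence\<close>

lemma M_independentD:
  "M_independent L M A C B \<Longrightarrow> C \<subseteq> D \<Longrightarrow> D \<subseteq> acl L M (B \<union> C) \<Longrightarrow>
     acl L M (A \<union> D) \<inter> acl L M (B \<union> D) = acl L M D"
  by (simp add: M_independent_def)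

lemma M_independent_mono:
  assumes "M_independent L M A C B" "A' \<subseteq> A" "B' \<subseteq> B"
  shows "M_independent L M A' C B'"
  unfolding M_independent_def
proof (intro allI impI)
  fix D assume D: "C \<subseteq> D" "D \<subseteq> acl L M (B' \<union> C)"
  have "acl L M (B' \<union> C) \<subseteq> acl L M (B \<union> C)"
    by (rule acl_mono) (use assms(3) in blast)
  then have "acl L M (A \<union> D) \<inter> acl L M (B \<union> D) = acl L M D"
    using M_independentD[OF assms(1) D(1)] D(2) by blast
  moreover have "acl L M (A' \<union> D) \<subseteq> acl L M (A \<union> D)" "acl L M (B' \<union> D) \<subseteq> acl L M (B \<union> D)"
    by (rule acl_mono, use assms(2,3) in blast)+
  moreover have "acl L M D \<subseteq> acl L M (A' \<union> D)" "acl L M D \<subseteq> acl L M (B' \<union> D)"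
    by (rule acl_mono, blast)+
  ultimately show "acl L M (A' \<union> D) \<inter> acl L M (B' \<union> D) = acl L M D" by blast
qed

lemma M_independent_finite_character:
  assumes "\<And>A0. A0 \<subseteq> A \<Longrightarrow> finite A0 \<Longrightarrow> M_independent L M A0 C B"
  shows "M_independent L M A C B"
  unfolding M_independent_def
proof (intro allI impI equalityI subsetI)
  fix D a assume D: "C \<subseteq> D" "D \<subseteq> acl L M (B \<union> C)"
    and a: "a \<in> acl L M (A \<union> D) \<inter> acl L M (B \<union> D)"
  then obtain S where S: "finite S" "S \<subseteq> A \<union> D" "a \<in> acl L M S"
    using acl_finite_character by (metis IntD1)
  have "S \<subseteq> (S \<inter> A) \<union> D" using S(2) by blast
  then have "a \<in> acl L M ((S \<inter> A) \<union> D)" by (rule subsetD[OF acl_mono S(3)])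
  moreover have "M_independent L M (S \<inter> A) C B"
    using assms S(1) by simp
  ultimately show "a \<in> acl L M D"
    using M_independentD[OF _ D] a by blast
next
  fix D a assume "a \<in> acl L M D"
  moreover have "acl L M D \<subseteq> acl L M (A \<union> D)" "acl L M D \<subseteq> acl L M (B \<union> D)"
    by (rule acl_mono, blast)+
  ultimately show "a \<in> acl L M (A \<union> D) \<inter> acl L M (B \<union> D)" by blast
qed

text \<open>An element of both closures over \<open>D\<close> first falls into
  \<open>acl (X \<union> D)\<close>, by the M-independence of \<open>A\<close> at the base
  \<open>X \<union> D\<close>, and then into \<open>acl D\<close>, by that of
  \<open>X\<close>.\<close>

lemma M_independent_Un_left:
  assumes "is_struct L M" and X: "M_independent L M X C B" and A: "M_independent L M A C (B \<union> X)"
  shows "M_independent L M (X \<union> A) C B"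
  unfolding M_independent_def
proof (intro allI impI equalityI subsetI)
  fix D a assume D: "C \<subseteq> D" "D \<subseteq> acl L M (B \<union> C)"
    and a: "a \<in> acl L M (X \<union> A \<union> D) \<inter> acl L M (B \<union> D)"
  have "B \<union> X \<union> C \<subseteq> acl L M (B \<union> X \<union> C)" by (rule subset_acl[OF assms(1)])
  moreover have "acl L M (B \<union> C) \<subseteq> acl L M (B \<union> X \<union> C)" by (rule acl_mono) blast
  ultimately have "X \<union> D \<subseteq> acl L M (B \<union> X \<union> C)" using D(2) by simp
  then have "acl L M (A \<union> (X \<union> D)) \<inter> acl L M (B \<union> X \<union> (X \<union> D)) = acl L M (X \<union> D)"
    using D(1) by (intro M_independentD[OF A]) auto
  moreover have "A \<union> (X \<union> D) = X \<union> A \<union> D" by blast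
  moreover have "acl L M (B \<union> D) \<subseteq> acl L M (B \<union> X \<union> (X \<union> D))"
    by (rule acl_mono) blast
  ultimately have "a \<in> acl L M (X \<union> D)" using a by auto
  then show "a \<in> acl L M D"
    using M_independentD[OF X D] a by blast
next
  fix D a assume "a \<in> acl L M D"
  moreover have "acl L M D \<subseteq> acl L M (X \<union> A \<union> D)" "acl L M D \<subseteq> acl L M (B \<union> D)"
    by (rule acl_mono, blast)+
  ultimately show "a \<in> acl L M (X \<union> A \<union> D) \<inter> acl L M (B \<union> D)" by blast
qed

text \<open>Automorphisms commute with \<open>acl\<close> and with intersections, so the condition
  at a base \<open>D\<close> follows from the one at its preimage \<open>D0\<close>.\<close>

lemma M_independent_image:
  assumes "is_struct L M" and g: "g \<in> automorphisms L M" and A: "M_independent L M A C B"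
  shows "M_independent L M (g ` A) (g ` C) (g ` B)"
  unfolding M_independent_def
proof (intro allI impI)
  fix D assume D: "g ` C \<subseteq> D" "D \<subseteq> acl L M (g ` B \<union> g ` C)"
  have b: "bij g" using g by (rule automorphism_bij)
  define D0 where "D0 = inv g ` D"
  have D0: "D = g ` D0" unfolding D0_def using b by (simp add: bij_is_surj image_f_inv_f)
  have acl: "acl L M (g ` S) = g ` acl L M S" for S
    using image_acl[OF assms(1) g] by simp
  have sub: "g ` S \<subseteq> g ` S' \<longleftrightarrow> S \<subseteq> S'" for S S'
    using b by (simp add: bij_is_inj inj_image_subset_iff)
  have "C \<subseteq> D0" "D0 \<subseteq> acl L M (B \<union> C)"
    using D unfolding D0 image_Un[symmetric] acl sub by simp_all
  then have "acl L M (A \<union> D0) \<inter> acl L M (B \<union> D0) = acl L M D0"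
    by (rule M_independentD[OF A])
  then show "acl L M (g ` A \<union> D) \<inter> acl L M (g ` B \<union> D) = acl L M D"
    unfolding D0 image_Un[symmetric] acl image_Int[OF bij_is_inj[OF b], symmetric] by simp
qed

section \<open>Conjugate sets\<close>

lemma equiv_over_sym:
  assumes "equiv_over L M E A A'"
  shows "equiv_over L M E A' A"
proof -
  obtain g where g: "g \<in> automorphisms L M" "\<forall>b\<in>E. g b = b" "g ` A = A'"
    using assms unfolding equiv_over_def by blast
  have b: "bij g" using g(1) by (rule automorphism_bij)
  have "\<forall>b\<in>E. inv g b = b" using g(2) b by (metis bij_inv_eq_iff)
  moreover have "inv g ` A' = A" using g(3) b by (metis bij_is_inj image_inv_f_f)
  ultimately show ?thesis using inv_automorphism[OF g(1)] unfolding equiv_over_def by blast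
qed

lemma equiv_over_trans:
  assumes "equiv_over L M E A A'" "equiv_over L M E A' A''"
  shows "equiv_over L M E A A''"
proof -
  obtain g where g: "g \<in> automorphisms L M" "\<forall>b\<in>E. g b = b" "g ` A = A'"
    using assms(1) unfolding equiv_over_def by blast
  obtain h where h: "h \<in> automorphisms L M" "\<forall>b\<in>E. h b = b" "h ` A' = A''"
    using assms(2) unfolding equiv_over_def by blast
  have "\<forall>b\<in>E. (h \<circ> g) b = b" "(h \<circ> g) ` A = A''" using g(2,3) h(2,3) by auto
  then show ?thesis
    using comp_automorphism[OF h(1) g(1)] unfolding equiv_over_def by blast
qed

lemma card_of_equiv_over: "equiv_over L M E A A' \<Longrightarrow> |A'| \<le>o |A|"
  unfolding equiv_over_def using card_of_image by blast

section \<open>Independence relations in a big model\<close>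

locale independence_in_big_model = independence_relation L \<kappa> M ind
  for L :: "('s, 'f, 'r) lang" and \<kappa> :: "'k rel"
    and M :: "('s, 'f, 'r, 'm) struct" and ind :: "'m ternary" +
  assumes struct: "is_struct L M"
    and big: "big_cardinal \<kappa>"
    and few_formulas: "|{p. wf_fm L p}| <o \<kappa>"
begin

section \<open>Closure properties of small sets\<close>

lemma Card_order_kappa: "Card_order \<kappa>" and natLeq_kappa: "natLeq <o \<kappa>"
  using big by (auto simp: big_cardinal_def)

lemma small_subset: "small \<kappa> A \<Longrightarrow> B \<subseteq> A \<Longrightarrow> small \<kappa> B"
  using card_of_mono1 ordLeq_ordLess_trans by blast

lemma small_Un: "small \<kappa> A \<Longrightarrow> small \<kappa> B \<Longrightarrow> small \<kappa> (A \<union> B)"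
  by (rule card_of_Un_ordLess_infinite_Field[OF infinite_Field[OF Card_order_kappa natLeq_kappa] Card_order_kappa])

lemma small_image: "small \<kappa> A \<Longrightarrow> small \<kappa> (f ` A)"
  using card_of_image ordLeq_ordLess_trans by blast

lemma small_finite: "finite A \<Longrightarrow> small \<kappa> A"
  using finite_iff_ordLess_natLeq natLeq_kappa ordLess_transitive by blast

lemma small_acl: "small \<kappa> A \<Longrightarrow> small \<kappa> (acl L M A)"
  by (rule card_of_acl_ordLess[OF Card_order_kappa natLeq_kappa few_formulas])

lemma small_equiv_over: "small \<kappa> A \<Longrightarrow> equiv_over L M E A A' \<Longrightarrow> small \<kappa> A'"
  using card_of_equiv_over ordLeq_ordLess_trans by blast

lemmas small_intros = small_Un small_image small_finite small_acl

section \<open>Consequences of the axioms that precede symmetry\<close>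

lemma ind_equiv_over:
  assumes s: "small \<kappa> A" "small \<kappa> B" "small \<kappa> C" and A: "ind A C B"
    and A': "equiv_over L M (B \<union> C) A A'"
  shows "ind A' C B"
proof -
  obtain g where g: "g \<in> automorphisms L M" "\<forall>b\<in>B \<union> C. g b = b" "g ` A = A'"
    using A' unfolding equiv_over_def by blast
  have "g ` C = C" "g ` B = B" using g(2) by force+
  then show ?thesis using invariance[OF s g(1) A] g(3) by simp
qed

text \<open>Extension gives a conjugate of \<open>A\<close> with the larger right-hand side. An
  automorphism over \<open>B \<union> C\<close> maps \<open>acl (B \<union> C)\<close> onto itself,
  so moving the conjugate back to \<open>A\<close> preserves the independence.\<close>

lemma ind_acl_right:
  assumes s: "small \<kappa> A" "small \<kappa> B" "small \<kappa> C" and A: "ind A C B"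
  shows "ind A C (acl L M (B \<union> C))"
proof -
  have "B \<subseteq> acl L M (B \<union> C)" using subset_acl[OF struct, of "B \<union> C"] by blast
  then obtain A' where A': "equiv_over L M (B \<union> C) A A'" "ind A' C (acl L M (B \<union> C))"
    using extension[OF s(1) small_acl[OF small_Un[OF s(2,3)]] s(3) A] by blast
  obtain g where g: "g \<in> automorphisms L M" "\<forall>b\<in>B \<union> C. g b = b" "g ` A' = A"
    using equiv_over_sym[OF A'(1)] unfolding equiv_over_def by blast
  have "g ` C = C" "g ` (B \<union> C) = B \<union> C" using g(2) by force+
  then have "g ` acl L M (B \<union> C) = acl L M (B \<union> C)"
    using image_acl[OF struct g(1)] by metis
  then show ?thesis
    using invariance[OF small_equiv_over[OF s(1) A'(1)] small_acl[OF small_Un[OF s(2,3)]] s(3) g(1) A'(2)]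
      g(3) \<open>g ` C = C\<close> by simp
qed

lemma ind_base_right:
  assumes "small \<kappa> A" "small \<kappa> B" "small \<kappa> C" "ind A C B"
  shows "ind A C (B \<union> C)"
  by (rule monotonicity[OF assms(1) _ assms(3) ind_acl_right[OF assms]])
    (use assms subset_acl[OF struct] in \<open>auto intro: small_intros\<close>)

text \<open>Base monotonicity wants the new base inside the right-hand side, so \<open>C\<close> is
  first added there and dropped afterwards.\<close>

lemma ind_increase_base:
  assumes "small \<kappa> A" "small \<kappa> B" "ind A C B" "C \<subseteq> D" "D \<subseteq> B \<union> C" "small \<kappa> C"
  shows "ind A D B"
proof -
  have "ind A D (B \<union> C)"
    by (rule base_monotonicity[OF assms(1) small_Un[OF assms(2,6)] assms(4,5)])
      (rule ind_base_right[OF assms(1,2,6,3)])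
  moreover have "small \<kappa> D" using assms(2,5,6) small_subset small_Un by blast
  ultimately show ?thesis
    using monotonicity[OF assms(1) small_Un[OF assms(2,6)]] by blast
qed

text \<open>Local character gives independence over some subset of \<open>C\<close>, and base
  monotonicity raises this subset to \<open>C\<close>.\<close>

lemma ind_self_base:
  assumes "small \<kappa> A" "small \<kappa> C"
  shows "ind A C C"
proof -
  obtain D where "D \<subseteq> C" "ind A D C" using local_character[OF assms(1)] assms(2) by blast
  then show ?thesis using base_monotonicity[OF assms, of D C] by blast
qed

text \<open>The transitivity axiom speaks of nested sets; normality produces the chain from
  \<open>C\<close> through \<open>C \<union> X\<close> to
  \<open>A \<union> (C \<union> X)\<close>.\<close>

lemma ind_Un_left:
  assumes s: "small \<kappa> A" "small \<kappa> X" "small \<kappa> C" "small \<kappa> B"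
    and X: "ind X C B" and A: "ind A (C \<union> X) B"
  shows "ind (A \<union> X) C B"
proof -
  have "ind (A \<union> (C \<union> X)) (C \<union> X) B"
    using normality[OF s(1,4) small_Un[OF s(3,2)] A] .
  moreover have "ind (C \<union> X) C B"
    using normality[OF s(2,4,3) X] by (simp add: Un_commute)
  ultimately have "ind (A \<union> (C \<union> X)) C B"
    by (intro transitivity[of B "A \<union> (C \<union> X)" C "C \<union> X"]) (auto intro: small_intros s)
  then show ?thesis
    by (rule monotonicity[rotated 3]) (auto intro: small_intros s)
qed

text \<open>Conjugating the independent copy of \<open>X\<close> given by extension back to \<open>X\<close> moves \<open>A\<close> instead.\<close>

lemma exists_conjugate_ind:
  assumes s: "small \<kappa> A" "small \<kappa> X" "small \<kappa> C" "small \<kappa> B" and X: "ind X C B"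
  shows "\<exists>A'. equiv_over L M (B \<union> C) A A' \<and> ind X C (A' \<union> B)"
proof -
  obtain X' where X': "equiv_over L M (B \<union> C) X X'" "ind X' C (A \<union> B)"
    using extension[OF s(2) small_Un[OF s(1,4)] s(3) X] by blast
  obtain g where g: "g \<in> automorphisms L M" "\<forall>b\<in>B \<union> C. g b = b" "g ` X' = X"
    using equiv_over_sym[OF X'(1)] unfolding equiv_over_def by blast
  have "ind (g ` X') (g ` C) (g ` (A \<union> B))"
    by (rule invariance[OF small_equiv_over[OF s(2) X'(1)] small_Un[OF s(1,4)] s(3) g(1) X'(2)])
  moreover have "g ` C = C" "g ` B = B" using g(2) by force+
  ultimately have "ind X C (g ` A \<union> B)" using g(3) by (simp add: image_Un)
  moreover have "equiv_over L M (B \<union> C) A (g ` A)" using g unfolding equiv_over_def by blast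
  ultimately show ?thesis by blast
qed

text \<open>A sequence \<open>F\<close> of conjugates of \<open>A\<close> that is longer than the local character of \<open>Z\<close>:
  an image of \<open>Z\<close> is independent from the whole sequence over an initial segment, hence from the
  next term over the terms before it.\<close>

lemma long_sequence:
  assumes s: "small \<kappa> A" "small \<kappa> C" "small \<kappa> Z"
    and Q_empty: "Q {}"
    and Q_finite: "\<And>X. small \<kappa> X \<Longrightarrow> (\<And>X0. X0 \<subseteq> X \<Longrightarrow> finite X0 \<Longrightarrow> Q X0) \<Longrightarrow> Q X"
    and Q_mono: "\<And>X X0. small \<kappa> X \<Longrightarrow> Q X \<Longrightarrow> X0 \<subseteq> X \<Longrightarrow> Q X0"
    and Q_Un: "\<And>X A'. small \<kappa> X \<Longrightarrow> Q X \<Longrightarrow> equiv_over L M E A A' \<Longrightarrow> P X A' \<Longrightarrow> Q (X \<union> A')"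
    and step: "\<And>X. small \<kappa> X \<Longrightarrow> Q X \<Longrightarrow> \<exists>A'. equiv_over L M E A A' \<and> P X A'"
  obtains U where "small \<kappa> U"
    "\<And>g. g \<in> automorphisms L M \<Longrightarrow> \<exists>X A'. X \<subseteq> U \<and> A' \<subseteq> U \<and> Q X \<and> P X A' \<and>
       equiv_over L M E A A' \<and> ind (g ` Z) (C \<union> X) A'"
proof -
  obtain \<mu> :: "'k rel" where \<mu>: "Card_order \<mu>" "\<mu> <o \<kappa>"
    "\<And>B. small \<kappa> B \<Longrightarrow> \<exists>D\<subseteq>B. |D| <o \<mu> \<and> ind Z D B"
    using local_character[OF s(3)] by blast
  define \<nu> where "\<nu> = |Field \<mu> <+> (UNIV :: nat set)|"
  have \<nu>: "Card_order \<nu>" "\<not> finite (Field \<nu>)" unfolding \<nu>_def by (simp_all add: Field_card_of card_of_card_order_on)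
  have "\<mu> =o |Field \<mu>|" using \<mu>(1) card_of_Field_ordIso ordIso_symmetric by blast
  then have \<mu>\<nu>: "\<mu> \<le>o \<nu>" unfolding \<nu>_def using card_of_Plus1 ordIso_ordLeq_trans by blast
  have "|Field \<mu>| <o \<kappa>" using \<open>\<mu> =o |Field \<mu>|\<close> \<mu>(2) ordIso_symmetric ordIso_ordLess_trans by blast
  moreover have "|UNIV :: nat set| <o \<kappa>"
    using natLeq_kappa card_of_nat ordIso_ordLess_trans by blast
  ultimately have "\<nu> <o \<kappa>" unfolding \<nu>_def
    by (rule card_of_Plus_ordLess_infinite_Field[OF infinite_Field[OF Card_order_kappa natLeq_kappa] Card_order_kappa])
  \<comment> \<open>\<open>\<nu>\<close> is an infinite cardinal at least \<open>\<mu>\<close>, so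
    its successor is regular: a set of at most \<open>\<nu>\<close> elements covered by a chain of
    length \<open>r\<close> lies in one member of the chain.\<close>
  define r where "r = cardSuc \<nu>"
  have r: "Card_order r" "r <o \<kappa>" "\<not> finite (Field r)"
    unfolding r_def using \<nu> big_cardinal_cardSuc[OF big \<nu>(1) \<open>\<nu> <o \<kappa>\<close>]
    by (auto simp: cardSuc_Card_order cardSuc_finite)
  have Wr: "Well_order r" using r(1) unfolding card_order_on_def by auto
  then interpret r: wo_rel r by (simp add: wo_rel_def)
  have tr: "(x, z) \<in> r" if "(x, y) \<in> r" "(y, z) \<in> r" for x y z
    using r.TRANS that by (meson transD)
  have an: "x = y" if "(x, y) \<in> r" "(y, x) \<in> r" for x y
    using r.ANTISYM that by (meson antisymD)
  have underS_sub: "underS r y \<subseteq> underS r x" if "y \<in> underS r x \<or> (y, x) \<in> r" for x y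
    using that tr an unfolding underS_def by blast
  define before where "before = (\<lambda>F x. \<Union>y\<in>underS r x. F y :: 'm set)"
  have before_mono: "before F y \<subseteq> before F x" if "y \<in> underS r x \<or> (y, x) \<in> r" for F x y
    unfolding before_def by (rule UN_mono[OF underS_sub[OF that] order_refl])
  \<comment> \<open>\<open>Q\<close> is the invariant of initial segments and \<open>P\<close>
    relates a new term to the earlier ones. \<open>G\<close> makes \<open>A'\<close> an admissible
    value at \<open>x\<close>; it depends only on the values before \<open>x\<close>, as
    well-founded recursion requires.\<close>
  define G where "G = (\<lambda>F x A'. Q (before F x) \<and> equiv_over L M E A A' \<and> P (before F x) A')"
  have small_family: "small \<kappa> (\<Union>y\<in>Y. F y)"
    if "\<And>y. y \<in> Y \<Longrightarrow> equiv_over L M E A (F y)" "Y \<subseteq> Field r" for Y F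
  proof -
    let ?J = "Field r <+> A"
    have inf: "\<not> finite ?J" using r(3) by simp
    have "|\<Union>y\<in>Y. F y| \<le>o |?J|"
    proof (rule card_of_UNION_ordLeq_infinite[OF inf])
      show "|Y| \<le>o |?J|"
        by (rule ordLeq_transitive[OF card_of_mono1[OF that(2)] card_of_Plus1])
      show "\<forall>y\<in>Y. |F y| \<le>o |?J|"
        using that(1) card_of_equiv_over card_of_Plus2 ordLeq_transitive by blast
    qed
    moreover have "|Field r| <o \<kappa>"
      using r(1,2) card_of_Field_ordIso ordIso_ordLess_trans by blast
    then have "|?J| <o \<kappa>"
      by (rule card_of_Plus_ordLess_infinite_Field[OF
          infinite_Field[OF Card_order_kappa natLeq_kappa] Card_order_kappa _ s(1)])
    ultimately show ?thesis by (rule ordLeq_ordLess_trans)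
  qed
  have underS_Field: "underS r x \<subseteq> Field r" for x
    by (auto simp: underS_def Field_def)
  have "\<exists>F. \<forall>x. G F x (F x)"
  proof (rule dependent_wf_choice)
    show "wf (r - Id)" using r.WF by simp
    fix F F' :: "('k + nat) set \<Rightarrow> 'm set" and x A'
    assume "\<And>z. (z, x) \<in> r - Id \<Longrightarrow> F z = F' z"
    then have "before F x = before F' x"
      unfolding before_def underS_def by auto
    then show "G F x A' = G F' x A'" unfolding G_def by simp
  next
    fix x and F :: "('k + nat) set \<Rightarrow> 'm set"
    assume IH: "\<And>y. (y, x) \<in> r - Id \<Longrightarrow> G F y (F y)"
    then have IH': "G F y (F y)" if "y \<in> underS r x" for y
      using that by (auto simp: underS_def)
    have sm: "small \<kappa> (before F x)"
      unfolding before_def using IH' underS_Field by (intro small_family) (auto simp: G_def)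
    \<comment> \<open>A nonempty finite subset lies in an initial segment that ends with a single
      earlier term, where \<open>Q\<close> holds by \<open>Q_Un\<close>. This treats successor and
      limit stages alike.\<close>
    have "Q (before F x)"
    proof (rule Q_finite[OF sm])
      fix X0 assume X0: "X0 \<subseteq> before F x" "finite X0"
      have "X0 = {} \<or> (\<exists>y\<in>underS r x. X0 \<subseteq> before F y \<union> F y)"
        using X0(2,1)
      proof (induction X0)
        case (insert a X0)
        obtain z where z: "z \<in> underS r x" "a \<in> F z"
          using insert.prems unfolding before_def by blast
        show ?case
        proof (cases "X0 = {}")
          case True
          then show ?thesis using z by blast
        next
          case False
          then obtain y where y: "y \<in> underS r x" "X0 \<subseteq> before F y \<union> F y"
            using insert by blast
          have "y \<in> Field r" "z \<in> Field r" using y(1) z(1) underS_Field by blast+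
          then consider "z = y" | "z \<in> underS r y" | "y \<in> underS r z"
            using r.TOTALS unfolding underS_def by blast
          then show ?thesis
          proof cases
            case 1
            then show ?thesis using y z by blast
          next
            case 2
            then show ?thesis using y z unfolding before_def by blast
          next
            case 3
            then have "before F y \<subseteq> before F z" by (intro before_mono disjI1)
            moreover have "F y \<subseteq> before F z" using 3 unfolding before_def by blast
            ultimately show ?thesis using y z by blast
          qed
        qed
      qed simp
      then show "Q X0"
      proof (elim disjE bexE)
        fix y assume y: "y \<in> underS r x" "X0 \<subseteq> before F y \<union> F y"
        have sy: "small \<kappa> (before F y)"
          by (rule small_subset[OF sm before_mono[OF disjI1[OF y(1)]]])
        have "equiv_over L M E A (F y)" using IH'[OF y(1)] by (simp add: G_def)
        then have "small \<kappa> (F y)" using small_equiv_over[OF s(1)] by blast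
        then have "small \<kappa> (before F y \<union> F y)" using sy small_Un by blast
        moreover have "Q (before F y \<union> F y)"
          using IH'[OF y(1)] Q_Un[OF sy] by (simp add: G_def)
        ultimately show ?thesis using Q_mono y(2) by blast
      qed (use Q_empty in simp)
    qed
    then show "\<exists>A'. G F x A'" using step[OF sm] unfolding G_def by blast
  qed
  then obtain F where F: "\<And>x. Q (before F x)" "\<And>x. equiv_over L M E A (F x)"
    "\<And>x. P (before F x) (F x)"
    unfolding G_def by blast
  define U where "U = (\<Union>x\<in>Field r. F x)"
  have U: "small \<kappa> U" unfolding U_def using F(2) by (intro small_family) auto
  have before_U: "before F x \<subseteq> U" for x
    unfolding before_def U_def using underS_Field by blast
  have lim: "\<exists>y\<in>Field r. x \<in> underS r y" if "x \<in> Field r" for x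
    using infinite_Card_order_limit[OF r(1,3) that] unfolding underS_def by blast
  have "\<exists>X A'. X \<subseteq> U \<and> A' \<subseteq> U \<and> Q X \<and> P X A' \<and> equiv_over L M E A A' \<and> ind (g ` Z) (C \<union> X) A'"
    if g: "g \<in> automorphisms L M" for g
  proof -
    have b: "bij g" using g by (rule automorphism_bij)
    let ?V = "C \<union> U"
    have sV: "small \<kappa> ?V" using s(2) U small_Un by blast
    \<comment> \<open>The bound \<open>\<mu>\<close> belongs to \<open>Z\<close> and was fixed
      before \<open>g\<close>. Hence local character is applied to \<open>Z\<close> and the preimage
      of \<open>?V\<close>, and the result is transported by \<open>g\<close>.\<close>
    obtain D0 where D0: "D0 \<subseteq> inv g ` ?V" "|D0| <o \<mu>" "ind Z D0 (inv g ` ?V)"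
      using \<mu>(3)[OF small_image[OF sV]] by blast
    define D where "D = g ` D0"
    have gV: "g ` inv g ` ?V = ?V" using b by (simp add: bij_is_surj image_f_inv_f)
    have sD0: "small \<kappa> D0" using small_subset[OF small_image[OF sV] D0(1)] .
    have "D \<subseteq> g ` inv g ` ?V" unfolding D_def by (rule image_mono[OF D0(1)])
    moreover have "ind (g ` Z) D (g ` inv g ` ?V)"
      unfolding D_def by (rule invariance[OF s(3) small_image[OF sV] sD0 g D0(3)])
    ultimately have D: "D \<subseteq> ?V" "ind (g ` Z) D ?V" unfolding gV .
    have "|D| \<le>o |D0|" unfolding D_def by (rule card_of_image)
    then have "|D| \<le>o \<nu>"
      by (rule ordLeq_transitive[OF _ ordLeq_transitive[OF ordLess_imp_ordLeq[OF D0(2)] \<mu>\<nu>]])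
    define As where "As = (\<lambda>x. C \<union> before F x)"
    have "relChain r As"
      unfolding relChain_def As_def by (intro allI impI Un_mono order_refl before_mono disjI2)
    moreover have "D \<subseteq> (\<Union>x\<in>Field r. As x)"
    proof
      fix a assume "a \<in> D"
      then consider "a \<in> C" | y where "y \<in> Field r" "a \<in> F y"
        using D(1) unfolding U_def by blast
      then show "a \<in> (\<Union>x\<in>Field r. As x)"
      proof cases
        case 1
        moreover obtain x0 where "x0 \<in> Field r" using r(3) by fastforce
        ultimately show ?thesis unfolding As_def by blast
      next
        case 2
        then obtain x where "x \<in> Field r" "y \<in> underS r x" using lim by blast
        then show ?thesis using 2(2) unfolding As_def before_def by blast
      qed
    qed
    \<comment> \<open>By regularity the base \<open>D\<close> is contained in one
      \<open>As x\<close>; base monotonicity then raises \<open>D\<close> to \<open>As x\<close>,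
      and the next term \<open>F x\<close> remains on the right.\<close>
    ultimately obtain x where x: "x \<in> Field r" "D \<subseteq> As x"
      using cardSuc_UNION[OF \<nu> _ _ \<open>|D| \<le>o \<nu>\<close>, of As] unfolding r_def by blast
    have sZ: "small \<kappa> (g ` Z)" using s(3) by (rule small_image)
    have "ind (g ` Z) (As x) ?V"
      by (rule base_monotonicity[OF sZ sV x(2) _ D(2)]) (use before_U in \<open>auto simp: As_def\<close>)
    moreover have "F x \<subseteq> U" using x(1) unfolding U_def by blast
    moreover have "small \<kappa> (As x)"
      unfolding As_def by (rule small_Un[OF s(2) small_subset[OF U before_U]])
    ultimately have "ind (g ` Z) (As x) (F x)"
      using monotonicity[OF sZ sV] by blast
    then have "before F x \<subseteq> U \<and> F x \<subseteq> U \<and> Q (before F x) \<and> P (before F x) (F x) \<and>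
        equiv_over L M E A (F x) \<and> ind (g ` Z) (C \<union> before F x) (F x)"
      using F before_U \<open>F x \<subseteq> U\<close> unfolding As_def by simp
    then show ?thesis by (intro exI)
  qed
  with U show thesis by (rule that)
qed

text \<open>In a long sequence of conjugates of \<open>A\<close>, each initial segment
  \<open>X\<close> is independent from the next term \<open>A'\<close> over \<open>C\<close>. By
  local character, \<open>B\<close> is independent from some \<open>A'\<close> over
  \<open>C \<union> X\<close>. Left transitivity removes \<open>X\<close>, and an automorphism over
  \<open>B \<union> C\<close> carries \<open>A'\<close> to \<open>A\<close>.\<close>

lemma symmetry:
  assumes s: "small \<kappa> A" "small \<kappa> B" "small \<kappa> C" and A: "ind A C B"
  shows "ind B C A"
proof -
  obtain U where U: "small \<kappa> U" "\<And>g. g \<in> automorphisms L M \<Longrightarrow> \<exists>X A'. X \<subseteq> U \<and> A' \<subseteq> U \<and>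
      ind X C B \<and> ind X C (A' \<union> B) \<and> equiv_over L M (B \<union> C) A A' \<and> ind (g ` B) (C \<union> X) A'"
  proof (rule long_sequence[OF s(1,3,2), where Q = "\<lambda>X. ind X C B" and P = "\<lambda>X A'. ind X C (A' \<union> B)"
        and E = "B \<union> C"])
    show "ind {} C B" using monotonicity[OF s A] by blast
    show "ind X C B" if "small \<kappa> X" "\<And>X0. X0 \<subseteq> X \<Longrightarrow> finite X0 \<Longrightarrow> ind X0 C B" for X
      using finite_character[OF that(1) s(2,3)] that(2) by blast
    show "ind X0 C B" if "small \<kappa> X" "ind X C B" "X0 \<subseteq> X" for X X0
      using monotonicity[OF that(1) s(2,3) that(2,3)] by blast
    show "\<exists>A'. equiv_over L M (B \<union> C) A A' \<and> ind X C (A' \<union> B)" if "small \<kappa> X" "ind X C B" for X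
      by (rule exists_conjugate_ind[OF s(1) that(1) s(3,2) that(2)])
    show "ind (X \<union> A') C B" if X: "small \<kappa> X"
      and A': "equiv_over L M (B \<union> C) A A'" and XA: "ind X C (A' \<union> B)" for X A'
    proof (rule ind_Un_left[OF X _ s(3,2)])
      show sA': "small \<kappa> A'" using small_equiv_over[OF s(1) A'] .
      show "ind A' C B" using ind_equiv_over[OF s A A'] .
      \<comment> \<open>This is why \<open>P\<close> keeps \<open>A'\<close> and \<open>B\<close>
        together on the right: \<open>A'\<close> can be moved into the base, as left transitivity
        demands.\<close>
      have "ind X (C \<union> A') (A' \<union> B)"
        by (rule ind_increase_base[OF X _ XA]) (auto intro: small_intros sA' s)
      then show "ind X (C \<union> A') B"
        by (rule monotonicity[OF X small_Un[OF sA' s(2)] small_Un[OF s(3) sA']]) auto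
    qed
  qed (use that in blast)
  obtain X A' where X: "X \<subseteq> U" "A' \<subseteq> U" "ind X C (A' \<union> B)"
    "equiv_over L M (B \<union> C) A A'" "ind B (C \<union> X) A'"
    using U(2)[OF id_automorphism] by auto
  have sX: "small \<kappa> X" "small \<kappa> A'" using small_subset[OF U(1)] X by blast+
  have "ind X C A'"
    by (rule monotonicity[OF sX(1) _ s(3) X(3)]) (auto intro: small_intros sX s)
  then have "ind (B \<union> X) C A'" by (rule ind_Un_left[OF s(2) sX(1) s(3) sX(2) _ X(5)])
  then have BA': "ind B C A'"
    by (rule monotonicity[OF small_Un[OF s(2) sX(1)] sX(2) s(3)]) auto
  obtain g where g: "g \<in> automorphisms L M" "\<forall>b\<in>B \<union> C. g b = b" "g ` A' = A"
    using equiv_over_sym[OF X(4)] unfolding equiv_over_def by blast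
  moreover have "g ` C = C" "g ` B = B" using g(2) by force+
  ultimately show ?thesis using invariance[OF s(2) sX(2) s(3) g(1) BA'] by simp
qed

text \<open>The mirror image of \<open>ind_Un_left\<close> under symmetry.\<close>

lemma ind_Un_right:
  assumes s: "small \<kappa> A" "small \<kappa> X" "small \<kappa> C" "small \<kappa> B"
    and X: "ind A C X" and A: "ind A (C \<union> X) B"
  shows "ind A C (B \<union> X)"
proof -
  have "ind (B \<union> X) C A"
    by (rule ind_Un_left[OF s(4,2,3,1) symmetry[OF s(1,2,3) X]])
      (rule symmetry[OF s(1,4) small_Un[OF s(3,2)] A])
  then show ?thesis by (rule symmetry[OF small_Un[OF s(4,2)] s(1,3)])
qed

text \<open>Among many conjugates of \<open>Y\<close> that are independent over \<open>B \<union> C\<close>, one is independent from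
  \<open>A\<close>, by local character.\<close>

lemma thorn_independent_extension_ind:
  assumes s: "small \<kappa> A" "small \<kappa> B" "small \<kappa> C" "small \<kappa> Y"
    and A: "thorn_independent L \<kappa> M A C B"
  shows "\<exists>A'. equiv_over L M (B \<union> C) A A' \<and> ind A' (B \<union> C) Y \<and> M_independent L M A' C (B \<union> Y)"
proof -
  let ?E = "B \<union> C"
  have sE: "small \<kappa> ?E" using s small_Un by blast
  obtain U where U: "small \<kappa> U" "\<And>g. g \<in> automorphisms L M \<Longrightarrow> \<exists>X Y'. X \<subseteq> U \<and> Y' \<subseteq> U \<and>
      ind X ?E Y' \<and> equiv_over L M ?E Y Y' \<and> ind (g ` A) (?E \<union> X) Y'"
  \<comment> \<open>A trivial invariant suffices, since every small \<open>X\<close> is independent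
    from \<open>?E\<close> over \<open>?E\<close> and so admits a further conjugate of
    \<open>Y\<close>.\<close>
  proof (rule long_sequence[OF s(4) sE s(1), where Q = "\<lambda>X. True" and P = "\<lambda>X Y'. ind X ?E Y'"
        and E = ?E])
    fix X :: "'m set" assume X: "small \<kappa> X"
    obtain Y' where Y': "equiv_over L M (?E \<union> ?E) Y Y'" "ind X ?E (Y' \<union> ?E)"
      using exists_conjugate_ind[OF s(4) X sE sE ind_self_base[OF X sE]] by blast
    have "ind X ?E Y'"
      by (rule monotonicity[OF X _ sE Y'(2)])
        (auto intro: small_intros small_equiv_over[OF s(4) Y'(1)] s)
    then show "\<exists>Y'. equiv_over L M ?E Y Y' \<and> ind X ?E Y'" using Y'(1) by auto
  qed (use that in auto)
  \<comment> \<open>Thorn-independence is applied to the whole of \<open>B \<union> U\<close>, so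
    that it covers whichever term is selected later. As \<open>A1\<close> depends on
    \<open>U\<close>, the sequence has to serve all images of \<open>A\<close> under
    automorphisms.\<close>
  obtain A1 where A1: "equiv_over L M ?E A A1" "M_independent L M A1 C (B \<union> U)"
    using A small_Un[OF s(2) U(1)] unfolding thorn_independent_def by blast
  obtain g where g: "g \<in> automorphisms L M" "g ` A = A1"
    using A1(1) unfolding equiv_over_def by blast
  obtain X Y' where X: "X \<subseteq> U" "Y' \<subseteq> U" "ind X ?E Y'" "equiv_over L M ?E Y Y'" "ind A1 (?E \<union> X) Y'"
    using U(2)[OF g(1)] g(2) by blast
  have sX: "small \<kappa> X" "small \<kappa> Y'" using small_subset[OF U(1)] X by blast+
  have sA1: "small \<kappa> A1" using small_equiv_over[OF s(1) A1(1)] .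
  have "ind (A1 \<union> X) ?E Y'" by (rule ind_Un_left[OF sA1 sX(1) sE sX(2) X(3,5)])
  then have i: "ind A1 ?E Y'"
    by (rule monotonicity[OF small_Un[OF sA1 sX(1)] sX(2) sE]) auto
  have m: "M_independent L M A1 C (B \<union> Y')"
    by (rule M_independent_mono[OF A1(2)]) (use X(2) in auto)
  \<comment> \<open>Moving the selected conjugate \<open>Y'\<close> back to \<open>Y\<close> turns
    \<open>A1\<close> into the required conjugate of \<open>A\<close>.\<close>
  obtain h where h: "h \<in> automorphisms L M" "\<forall>b\<in>?E. h b = b" "h ` Y' = Y"
    using equiv_over_sym[OF X(4)] unfolding equiv_over_def by blast
  have hE: "h ` ?E = ?E" "h ` C = C" "h ` B = B" using h(2) by force+
  have "ind (h ` A1) ?E Y" using invariance[OF sA1 sX(2) sE h(1) i] hE(1) h(3) by simp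
  moreover have "M_independent L M (h ` A1) C (B \<union> Y)"
    using M_independent_image[OF struct h(1) m] hE h(3) by (simp add: image_Un)
  moreover have "equiv_over L M ?E A (h ` A1)"
    using equiv_over_trans[OF A1(1)] h(1,2) unfolding equiv_over_def by blast
  ultimately show ?thesis by blast
qed

end

section \<open>From independence to thorn-independence\<close>

locale strict_independence_in_big_model = independence_in_big_model + strict_independence_relation
begin

text \<open>A common element \<open>a\<close> of the two closures is independent from itself over
  \<open>D\<close>: closing the right-hand side and shrinking it to \<open>a\<close>, then doing the
  same on the other side after symmetry. Anti-reflexivity puts \<open>a\<close> into
  \<open>acl D\<close>.\<close>

lemma ind_imp_M_independent:
  assumes s: "small \<kappa> A" "small \<kappa> B" "small \<kappa> C" and A: "ind A C B"
  shows "M_independent L M A C B"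
  unfolding M_independent_def
proof (intro allI impI equalityI subsetI)
  fix D a assume D: "C \<subseteq> D" "D \<subseteq> acl L M (B \<union> C)"
    and a: "a \<in> acl L M (A \<union> D) \<inter> acl L M (B \<union> D)"
  have sD: "small \<kappa> D" using small_subset[OF small_acl[OF small_Un[OF s(2,3)]] D(2)] .
  have sB: "small \<kappa> (acl L M (B \<union> C))" using small_acl[OF small_Un[OF s(2,3)]] .
  have sa: "small \<kappa> {a}" by (rule small_finite) simp
  have "ind A D (acl L M (B \<union> C))"
    by (rule base_monotonicity[OF s(1) sB D ind_acl_right[OF s A]])
  moreover have "B \<subseteq> acl L M (B \<union> C)" using subset_acl[OF struct, of "B \<union> C"] by blast
  ultimately have "ind A D B" using monotonicity[OF s(1) sB sD] by blast
  then have "ind A D (acl L M (B \<union> D))" by (rule ind_acl_right[OF s(1,2) sD])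
  then have "ind A D {a}"
    using monotonicity[OF s(1) small_acl[OF small_Un[OF s(2) sD]] sD] a by blast
  then have "ind {a} D A" by (rule symmetry[OF s(1) sa sD])
  then have "ind {a} D (acl L M (A \<union> D))" by (rule ind_acl_right[OF sa s(1) sD])
  then have "ind {a} D {a}"
    using monotonicity[OF sa small_acl[OF small_Un[OF s(1) sD]] sD] a by blast
  then show "a \<in> acl L M D" by (rule anti_reflexivity[OF sD])
next
  fix D a assume "a \<in> acl L M D"
  moreover have "acl L M D \<subseteq> acl L M (A \<union> D)" "acl L M D \<subseteq> acl L M (B \<union> D)"
    by (rule acl_mono, blast)+
  ultimately show "a \<in> acl L M (A \<union> D) \<inter> acl L M (B \<union> D)" by blast
qed

lemma ind_imp_thorn_independent:
  assumes s: "small \<kappa> A" "small \<kappa> B" "small \<kappa> C" and A: "ind A C B"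
  shows "thorn_independent L \<kappa> M A C B"
  unfolding thorn_independent_def
proof (intro allI impI)
  fix B' assume B': "small \<kappa> B'" "B \<subseteq> B'"
  then obtain A' where A': "equiv_over L M (B \<union> C) A A'" "ind A' C B'"
    using extension[OF s(1) B'(1) s(3) A B'(2)] by blast
  then show "\<exists>A'. equiv_over L M (B \<union> C) A A' \<and> M_independent L M A' C B'"
    using ind_imp_M_independent[OF small_equiv_over[OF s(1) A'(1)] B'(1) s(3) A'(2)] by blast
qed

end

section \<open>From thorn-independence to independence\<close>

locale canonical_independence_in_big_model =
  strict_independence_in_big_model + canonical_independence_relation
begin

lemma thorn_independent_imp_ind:
  assumes s: "small \<kappa> A" "small \<kappa> B" "small \<kappa> C" and A: "thorn_independent L \<kappa> M A C B"
  shows "ind A C B"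
proof -
  let ?E = "B \<union> C"
  have sE: "small \<kappa> ?E" using s small_Un by blast
  obtain U where U: "small \<kappa> U" "\<And>g. g \<in> automorphisms L M \<Longrightarrow> \<exists>X A'. X \<subseteq> U \<and> A' \<subseteq> U \<and>
      M_independent L M X C B \<and> (ind A' ?E X \<and> M_independent L M A' C (B \<union> X)) \<and>
      equiv_over L M ?E A A' \<and> ind (g ` B) (C \<union> X) A'"
  \<comment> \<open>The invariant is M-independence of the initial segment from \<open>B\<close>.
    Each new term comes from \<open>thorn_independent_extension_ind\<close>, with the earlier terms
    \<open>X\<close> in the place of \<open>Y\<close>.\<close>
  proof (rule long_sequence[OF s(1,3,2), where Q = "\<lambda>X. M_independent L M X C B"
        and P = "\<lambda>X A'. ind A' ?E X \<and> M_independent L M A' C (B \<union> X)" and E = ?E])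
    show "M_independent L M {} C B"
      unfolding M_independent_def using acl_mono[of _ "B \<union> _" L M] by auto
    show "M_independent L M X C B"
      if "\<And>X0. X0 \<subseteq> X \<Longrightarrow> finite X0 \<Longrightarrow> M_independent L M X0 C B" for X
      using M_independent_finite_character that by blast
    show "M_independent L M X0 C B" if "M_independent L M X C B" "X0 \<subseteq> X" for X X0
      using M_independent_mono[OF that] by blast
    show "M_independent L M (X \<union> A') C B"
      if "M_independent L M X C B" "ind A' ?E X \<and> M_independent L M A' C (B \<union> X)" for X A'
      using M_independent_Un_left[OF struct that(1)] that(2) by blast
    show "\<exists>A'. equiv_over L M ?E A A' \<and> ind A' ?E X \<and> M_independent L M A' C (B \<union> X)"
      if "small \<kappa> X" for X
      by (rule thorn_independent_extension_ind[OF s that A])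
  qed (use that in blast)
  obtain X A' where X: "X \<subseteq> U" "A' \<subseteq> U" "M_independent L M X C B" "ind A' ?E X"
    "equiv_over L M ?E A A'" "ind B (C \<union> X) A'"
    using U(2)[OF id_automorphism] by auto
  have sX: "small \<kappa> X" "small \<kappa> A'" using small_subset[OF U(1)] X by blast+
  have sCX: "small \<kappa> (C \<union> X)" using s(3) sX(1) by (rule small_Un)
  let ?V = "B \<union> C \<union> X" and ?C = "acl L M C"
  have sV: "small \<kappa> ?V" and sC: "small \<kappa> ?C" by (auto intro: small_intros s sX)
  have "ind A' ?E ?V"
    using ind_base_right[OF sX(2,1) sE X(4)] by (simp add: Un_ac)
  moreover have "ind A' (C \<union> X) ?V"
    using ind_base_right[OF sX(2) s(2) sCX symmetry[OF s(2) sX(2) sCX X(6)]] by (simp add: Un_ac)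
  ultimately have "ind A' (acl L M ?E \<inter> acl L M (C \<union> X)) ?V"
    by (intro intersection_property[OF sX(2) sV]) auto
  \<comment> \<open>M-independence of \<open>X\<close> from \<open>B\<close>, taken at the base
    \<open>C\<close> itself, computes the intersection given by the intersection property.\<close>
  moreover have "acl L M (X \<union> C) \<inter> acl L M ?E = ?C"
    using M_independentD[OF X(3) order_refl] subset_acl[OF struct, of ?E] by blast
  then have "acl L M ?E \<inter> acl L M (C \<union> X) = ?C"
    by (simp add: Int_commute Un_commute)
  ultimately have "ind A' ?C ?V" by simp
  then have "ind A' ?C B"
    using monotonicity[OF sX(2) sV sC] by blast
  moreover have CC: "C \<union> ?C = ?C" using subset_acl[OF struct] by blast
  \<comment> \<open>Independence from \<open>acl C\<close> over \<open>C\<close> is automatic, so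
    transitivity on the right lowers the base from \<open>acl C\<close> to \<open>C\<close>.\<close>
  moreover have "ind A' C ?C"
    using ind_acl_right[OF sX(2) s(3,3) ind_self_base[OF sX(2) s(3)]] by simp
  ultimately have "ind A' C (B \<union> ?C)"
    by (intro ind_Un_right[OF sX(2) sC s(3,2)]) simp_all
  then have "ind A' C B"
    using monotonicity[OF sX(2) small_Un[OF s(2) sC] s(3)] by blast
  then show ?thesis
    by (rule ind_equiv_over[OF sX(2) s(2,3) _ equiv_over_sym[OF X(5)]])
qed

end

theorem theorem3p3:
  fixes L :: "('s, 'f, 'r) lang"
    and T :: "('s, 'f, 'r) fm set"
    and \<kappa> :: "'k rel"
    and M :: "('s, 'f, 'r, 'm) struct"
    and ind :: "'m set \<Rightarrow> 'm set \<Rightarrow> 'm set \<Rightarrow> bool"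
  assumes "complete_theory L T"
    and "big_saturated_model L T \<kappa> M"
    and "canonical_independence_relation L \<kappa> M ind"
  shows "\<forall>A B C. small \<kappa> A \<longrightarrow> small \<kappa> B \<longrightarrow> small \<kappa> C \<longrightarrow>
           (ind A C B \<longleftrightarrow> thorn_independent L \<kappa> M A C B)"
proof -
  interpret canonical_independence_relation L \<kappa> M ind by (rule assms(3))
  interpret canonical_independence_in_big_model L \<kappa> M ind
    by unfold_locales (use assms(2) in \<open>simp_all add: big_saturated_model_def models_def\<close>)
  show ?thesis using ind_imp_thorn_independent thorn_independent_imp_ind by blast
qed

end
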